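(* Let $p,q\ge1$, $\alpha\in(0,1)$, and let $(\mathcal{X}\times\Omega,d_{\mathcal{X}},\mu)$, $(\mathcal{Y}\times\Omega,d_{\mathcal{Y}},\nu)$ belong to $\mathbb{S}_{pq}(\Omega)$. The functional $\pi\mapsto E_{p,q,\alpha}(\pi)$ attains its infimum over $\Pi(\mu,\nu)$ at some $\pi^*$, with $FGW_{\alpha,p,q}(\mu,\nu)=E_{p,q,\alpha}(\pi^* )^{1/p}<+\infty$. Moreover: (i) $FGW_{\alpha,p,q}$ is symmetric and, for $q=1$, satisfies the triangle inequality. For $q\ge2$ the triangle inequality is relaxed by a factor $2^{q-1}$, i.e. $FGW_{\alpha,p,q}(\mu,\nu)\le2^{q-1}\big(FGW_{\alpha,p,q}(\mu,\beta)+FGW_{\alpha,p,q}(\beta,\nu)\big)$. (ii) $FGW_{\alpha,p,q}(\mu,\nu)=0$ if and only if there exists a bijective function $\phi=(\phi_1,\phi_2):\mathrm{supp}(\mu)\to\mathrm{supp}(\nu)$ such that $\phi\#\mu=\nu$; $\phi_2(x,a)=a$ for all $(x,a)\in\mathrm{supp}(\mu)$; and $d_{\mathcal{X}}(x,x')=d_{\mathcal{Y}}(\phi_1(x,a),\phi_1(x',a'))$ for all $(x,a),(x',a')\in\mathrm{supp}(\mu)$. (iii) If $\mu$ and $\nu$ are generalized labeled graphs, then $FGW_{\alpha,p,q}(\mu,\nu)=0$ if and only if $(\mathcal{X}\times\Omega,d_{\mathcal{X}},\mu)$ and $(\mathcal{Y}\times\Omega,d_{\mathcal{Y}},\nu)$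 are (II)-strongly isomorphic.
   Context: All metric spaces are complete and separable. A structured object over a metric space $(\Omega,d)$ is a triplet $(\mathcal{X}\times\Omega,d_{\mathcal{X}},\mu)$ with $(\mathcal{X},d_{\mathcal{X}})$ a metric space and $\mu$ a Borel probability measure on $\mathcal{X}\times\Omega$; $\mu_X,\mu_A$ are the marginals on $\mathcal{X}$ and $\Omega$. It belongs to $\mathbb{S}_r(\Omega)$ if $\int d(a,a_0)^r d\mu_A(a)<\infty$ (for some, equivalently any, $a_0$) and $\iint d_{\mathcal{X}}(x,x')^r d\mu_X(x)d\mu_X(x')<\infty$. $\Pi(\mu,\nu)$ is the set of couplings, $\#$ denotes push-forward, and $$E_{p,q,\alpha}(\pi)=\iint\big((1-\alpha)d(a,b)^q+\alpha|d_{\mathcal{X}}(x,x')-d_{\mathcal{Y}}(y,y')|^q\big)^p d\pi((x,a),(y,b))d\pi((x',a'),(y',b')),$$ $$FGW_{\alpha,p,q}(\mu,\nu)=\Big(\inf_{\pi\in\Pi(\mu,\nu)}E_{p,q,\alpha}(\pi)\Big)^{1/p}.$$ A structured object is a generalized labeled graph if there is a surjective $\ell_f:\mathcal{X}\to\Omega$ with $\ell_f\#\mu_X=\mu_A$ and $\mu=(\mathrm{id}\times\ell_f)\#\mu_X$, i.e. $\mu$ is the push-forward of $\mu_X$ by $x\mapsto(x,\ell_f(x))$. Two structured objects are (II)-strongly isomorphic if there is a surjective map $I:\mathrm{supp}(\mu_X)\to\mathrm{supp}(\nu_Y)$ with $I\#\mu_X=\nu_Y$ and $d_{\mathcal{X}}(x,x')=d_{\mathcal{Y}}(I(x),I(x'))$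 for all $x,x'\in\mathrm{supp}(\mu_X)$, such that $\phi(x,a)=(I(x),a)$ is a bijection from $\mathrm{supp}(\mu)$ to $\mathrm{supp}(\nu)$ and $\phi\#\mu=\nu$. *)

theory Defs
  imports "HOL-Probability.Probability"
begin

(* A complete separable metric space is a type of class polish_space, with metric dist; the metric
   of a structured object (X x Omega, d_X, mu) is therefore carried by the type 'x of the measure
   mu :: ('x * 'o) measure.  The product metric on 'x * 'o enters only through its topology. *)

definition structured_object :: "('x::polish_space \<times> 'o::polish_space) measure \<Rightarrow> bool" where
  "structured_object \<mu> \<longleftrightarrow> prob_space \<mu> \<and> sets \<mu> = sets borel"

definition marg_struct :: "('x::polish_space \<times> 'o::polish_space) measure \<Rightarrow> 'x measure" where
  "marg_struct \<mu> = distr \<mu> borel fst"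

definition marg_feat :: "('x::polish_space \<times> 'o::polish_space) measure \<Rightarrow> 'o measure" where
  "marg_feat \<mu> = distr \<mu> borel snd"

definition structured_objects :: "real \<Rightarrow> ('x::polish_space \<times> 'o::polish_space) measure set" where
  "structured_objects r = {\<mu>. structured_object \<mu> \<and>
     (\<exists>a0. (\<integral>\<^sup>+a. ennreal (dist a a0 powr r) \<partial>marg_feat \<mu>) < \<infinity>) \<and>
     (\<integral>\<^sup>+x'. (\<integral>\<^sup>+x. ennreal (dist x x' powr r) \<partial>marg_struct \<mu>) \<partial>marg_struct \<mu>) < \<infinity>}"

definition couplings ::
  "'a::topological_space measure \<Rightarrow> 'b::topological_space measure \<Rightarrow> ('a \<times> 'b) measure set" where
  "couplings \<mu> \<nu> = {\<pi>. sets \<pi> = sets borel \<and> distr \<pi> borel fst = \<mu> \<and> distr \<pi> borel snd = \<nu>}"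

definition fgw_cost :: "real \<Rightarrow> real \<Rightarrow> real \<Rightarrow>
    ('x::polish_space \<times> 'o::polish_space) \<times> ('y::polish_space \<times> 'o) \<Rightarrow> ('x \<times> 'o) \<times> ('y \<times> 'o) \<Rightarrow> real" where
  "fgw_cost p q \<alpha> = (\<lambda>((x, a), (y, b)) ((x', a'), (y', b')).
     ((1 - \<alpha>) * dist a b powr q + \<alpha> * \<bar>dist x x' - dist y y'\<bar> powr q) powr p)"

definition fgw_energy :: "real \<Rightarrow> real \<Rightarrow> real \<Rightarrow>
    (('x::polish_space \<times> 'o::polish_space) \<times> ('y::polish_space \<times> 'o)) measure \<Rightarrow> ennreal" where
  "fgw_energy p q \<alpha> \<pi> = (\<integral>\<^sup>+w'. (\<integral>\<^sup>+w. ennreal (fgw_cost p q \<alpha> w w') \<partial>\<pi>) \<partial>\<pi>)"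

(* Power with a positive exponent on [0, \<infinity>]; enn2real alone would send \<infinity> to 0. *)
definition ennreal_power :: "ennreal \<Rightarrow> real \<Rightarrow> ennreal" where
  "ennreal_power u s = (if u = \<infinity> then \<infinity> else ennreal (enn2real u powr s))"

definition FGW :: "real \<Rightarrow> real \<Rightarrow> real \<Rightarrow> ('x::polish_space \<times> 'o::polish_space) measure \<Rightarrow>
    ('y::polish_space \<times> 'o) measure \<Rightarrow> ennreal" where
  "FGW \<alpha> p q \<mu> \<nu> = ennreal_power (INF \<pi>\<in>couplings \<mu> \<nu>. fgw_energy p q \<alpha> \<pi>) (1 / p)"

(* For a Borel measure on a second countable space this intersection is itself of full measure,
   hence it is the smallest closed set of full measure. *)
definition msupport :: "'a::topological_space measure \<Rightarrow> 'a set" where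
  "msupport M = \<Inter>{C. closed C \<and> emeasure M (- C) = 0}"

(* f # M = N for a map f given only on S; in every use S is the support of M, so that no mass is
   lost.  The measurability has to be required: distr is junk on non-measurable maps. *)
definition push_forward_on :: "'a set \<Rightarrow> ('a \<Rightarrow> 'b) \<Rightarrow> 'a measure \<Rightarrow> 'b measure \<Rightarrow> bool" where
  "push_forward_on S f M N \<longleftrightarrow>
     f \<in> measurable (restrict_space M S) N \<and> distr (restrict_space M S) N f = N"

definition generalized_labeled_graph :: "('x::polish_space \<times> 'o::polish_space) measure \<Rightarrow> bool" where
  "generalized_labeled_graph \<mu> \<longleftrightarrow> structured_object \<mu> \<and>
     (\<exists>l :: 'x \<Rightarrow> 'o. surj l \<and> l \<in> borel_measurable borel \<and>
        distr (marg_struct \<mu>) borel l = marg_feat \<mu> \<and>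
        \<mu> = distr (marg_struct \<mu>) borel (\<lambda>x. (x, l x)))"

definition strongly_isomorphic_II :: "('x::polish_space \<times> 'o::polish_space) measure \<Rightarrow>
    ('y::polish_space \<times> 'o) measure \<Rightarrow> bool" where
  "strongly_isomorphic_II \<mu> \<nu> \<longleftrightarrow>
     (\<exists>I :: 'x \<Rightarrow> 'y.
        I ` msupport (marg_struct \<mu>) = msupport (marg_struct \<nu>) \<and>
        push_forward_on (msupport (marg_struct \<mu>)) I (marg_struct \<mu>) (marg_struct \<nu>) \<and>
        (\<forall>x\<in>msupport (marg_struct \<mu>). \<forall>x'\<in>msupport (marg_struct \<mu>).
           dist x x' = dist (I x) (I x')) \<and>
        bij_betw (\<lambda>(x, a). (I x, a)) (msupport \<mu>) (msupport \<nu>) \<and>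
        push_forward_on (msupport \<mu>) (\<lambda>(x, a). (I x, a)) \<mu> \<nu>)"

end

theory Submission
  imports Defs "HOL-Library.Diagonal_Subsequence"
begin

text \<open>
  Couplings of two fixed laws are compact in a strong sense: on a product of Polish spaces every set
  of the algebra generated by measurable rectangles is approximated by compact and open sets uniformly
  over all couplings, so a diagonal sequence converges setwise on a countable such algebra to a measure
  given by Caratheodory's theorem. The same applies to the squares \<open>\<pi> \<otimes> \<pi>\<close>, and the
  layer-cake formula makes the energy lower semicontinuous along the sequence; hence an optimal coupling
  exists.

  The integrand is the power \<open>p q\<close> of a weighted \<open>l\<^sup>q\<close>-norm, so the power \<open>1 / q\<close> of
  \<open>FGW\<close> is a genuine \<open>L\<^sup>p\<^sup>q\<close> quantity and satisfies the exact triangle inequality; the factor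
  \<open>2 powr (q - 1)\<close> is convexity of the power \<open>q\<close>.

  If the energy of a coupling vanishes, the cost vanishes on the square of its support by continuity, so
  the support is the graph of an isometry between the supports. Pushing the coupling forward to the
  structure spaces and applying the same argument yields a map that depends on the structure point only,
  which is (II)-strong isomorphism.
\<close>

section \<open>Compactness of couplings\<close>

text \<open>The energy is quadratic in the coupling, so a limit of \<pi> has to be a limit of \<pi>
  \<otimes> \<pi> as well. The marginals of these squares are the couplings themselves, which vary
  along the sequence; hence regularity is stated uniformly over a family of measures. For the fixed
  laws \<mu> and \<nu> the family is a singleton, and the estimate for rectangles sees marginals
  only, so it can be used twice: from the laws to the couplings, then from the couplings to their
  squares. The triangle inequality is shaped by the fact that the middle points of two glued
  couplings agree only up to \<delta>. This error enters a norm additively and is removed by letting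
  \<delta> tend to 0, which also leaves room to replace both infima by strictly positive bounds. For
  zero energy, equal features make the coupling isometric for the product metric. The first
  component of the resulting map might still depend on the feature, which is the reason for the
  second pass on the structure spaces.\<close>

instance prod :: (polish_space, polish_space) polish_space ..

definition borel_probs :: "'a::topological_space measure set" where
  "borel_probs = {M. prob_space M \<and> sets M = sets borel}"

lemma borel_probsD:
  assumes "M \<in> borel_probs"
  shows "prob_space M" "finite_measure M" "sigma_finite_measure M" "sets M = sets borel" "space M = UNIV"
proof -
  show "prob_space M" and s: "sets M = sets borel"
    using assms by (auto simp: borel_probs_def)
  then show "finite_measure M" "sigma_finite_measure M"
    by (simp_all add: prob_space.finite_measure prob_space_imp_sigma_finite)
  show "space M = UNIV"
    using sets_eq_imp_space_eq[OF s] by simp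
qed

lemma measurable_borel_probs: "M \<in> borel_probs \<Longrightarrow> measurable M N = measurable borel N"
  by (intro measurable_cong_sets) (simp_all add: borel_probsD)

text \<open>One pair \<open>K\<close>, \<open>U\<close> has to serve all measures of the family; for
  \<open>G = UNIV\<close> this is tightness. Given tightness, this sandwich between a compact and an
  open set is stable under unions and complements, and it passes to products.\<close>

definition uniformly_regular :: "'a::topological_space measure set \<Rightarrow> 'a set \<Rightarrow> bool" where
  "uniformly_regular \<M> G \<longleftrightarrow> G \<in> sets borel \<and>
     (\<forall>e>0. \<exists>K U. compact K \<and> open U \<and> K \<subseteq> G \<and> G \<subseteq> U \<and> (\<forall>M\<in>\<M>. measure M (U - K) \<le> e))"

lemma uniformly_regularE:
  assumes "uniformly_regular \<M> G" "e > 0"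
  obtains K U where "compact K" "open U" "K \<subseteq> G" "G \<subseteq> U" "\<And>M. M \<in> \<M> \<Longrightarrow> measure M (U - K) \<le> e"
  using assms unfolding uniformly_regular_def by meson

lemma uniformly_regular_subset:
  "uniformly_regular \<M> G \<Longrightarrow> \<N> \<subseteq> \<M> \<Longrightarrow> uniformly_regular \<N> G"
  unfolding uniformly_regular_def by (meson subsetD)

text \<open>Finite Borel measures on a Polish space are inner regular for compact sets (Ulam) and
  outer regular for open sets; each side contributes \<open>e / 2\<close>.\<close>

lemma uniformly_regular_singleton:
  fixes M :: "'a::polish_space measure"
  assumes M: "M \<in> borel_probs" and G: "G \<in> sets borel"
  shows "uniformly_regular {M} G"
proof -
  interpret prob_space M using M by (rule borel_probsD)
  note [simp] = borel_probsD(4,5)[OF M]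
  have fin: "emeasure M A \<noteq> \<infinity>" for A by simp
  have "\<exists>K U. compact K \<and> open U \<and> K \<subseteq> G \<and> G \<subseteq> U \<and> measure M (U - K) \<le> e" if e: "e > 0" for e :: real
  proof -
    have e2: "e / 2 > 0" using e by simp
    have "emeasure M (space M) \<noteq> \<infinity>" by (rule fin)
    note ir = inner_regular[OF borel_probsD(4)[OF M] this G] outer_regular[OF borel_probsD(4)[OF M] this G]
    have "{K. K \<subseteq> G \<and> compact K} \<noteq> {}" by (auto intro: exI[of _ "{}"])
    from SUP_approx_ennreal[OF e2 this ir(1) fin]
    obtain K where K: "K \<subseteq> G" "compact K" "emeasure M G < emeasure M K + ennreal (e/2)" by auto
    from INF_approx_ennreal[OF e2 ir(2) fin]
    obtain U where U: "G \<subseteq> U" "open U" "emeasure M U < emeasure M G + ennreal (e/2)" by auto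
    have Km: "K \<in> sets M" "U \<in> sets M" using K U by (auto intro: borel_compact)
    have "measure M U < measure M G + e/2" "measure M G < measure M K + e/2"
      using K(3) U(3) e by (simp_all add: emeasure_eq_measure ennreal_less_iff flip: ennreal_plus)
    moreover have "measure M (U - K) = measure M U - measure M K"
      using K U Km by (intro finite_measure_Diff) auto
    ultimately have "measure M (U - K) \<le> e" by simp
    then show ?thesis using K U by blast
  qed
  then show ?thesis using G by (auto simp: uniformly_regular_def)
qed

lemma measure_borel_mono:
  assumes "M \<in> borel_probs" "A \<subseteq> B" "B \<in> sets borel"
  shows "measure M A \<le> measure M B"
  using assms borel_probsD[OF assms(1)] by (intro finite_measure.finite_measure_mono) auto

lemma measure_borel_le_add:
  assumes M: "M \<in> borel_probs" and "A \<subseteq> B \<union> C" "B \<in> sets borel" "C \<in> sets borel"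
  shows "measure M A \<le> measure M B + measure M C"
proof -
  have "measure M A \<le> measure M (B \<union> C)" using assms by (intro measure_borel_mono) auto
  also have "\<dots> \<le> measure M B + measure M C"
    using assms borel_probsD[OF M] by (intro measure_Un_le) auto
  finally show ?thesis .
qed

lemma uniformly_regular_Un:
  fixes \<M> :: "'a::t2_space measure set"
  assumes "\<M> \<subseteq> borel_probs" and G: "uniformly_regular \<M> G" and H: "uniformly_regular \<M> H"
  shows "uniformly_regular \<M> (G \<union> H)"
  unfolding uniformly_regular_def
proof (intro conjI allI impI)
  show "G \<union> H \<in> sets borel" using G H by (auto simp: uniformly_regular_def)
  fix e :: real assume "e > 0"
  then have e: "e/2 > 0" by simp
  obtain K U where K: "compact K" "open U" "K \<subseteq> G" "G \<subseteq> U" "\<And>M. M \<in> \<M> \<Longrightarrow> measure M (U - K) \<le> e/2"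
    by (rule uniformly_regularE[OF G e]) (rule that)
  obtain L V where L: "compact L" "open V" "L \<subseteq> H" "H \<subseteq> V" "\<And>M. M \<in> \<M> \<Longrightarrow> measure M (V - L) \<le> e/2"
    by (rule uniformly_regularE[OF H e]) (rule that)
  have "measure M (U \<union> V - (K \<union> L)) \<le> e" if "M \<in> \<M>" for M
  proof -
    have "measure M (U \<union> V - (K \<union> L)) \<le> measure M (U - K) + measure M (V - L)"
      using that assms(1) K L by (intro measure_borel_le_add) (auto intro: borel_compact)
    then show ?thesis using K(5)[OF that] L(5)[OF that] by simp
  qed
  then show "\<exists>K U. compact K \<and> open U \<and> K \<subseteq> G \<union> H \<and> G \<union> H \<subseteq> U \<and> (\<forall>M\<in>\<M>. measure M (U - K) \<le> e)"
    using K L by (intro exI[of _ "K \<union> L"] exI[of _ "U \<union> V"]) auto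
qed

text \<open>The complement of \<open>K\<close> is open, but the complement of \<open>U\<close> is
  merely closed. Tightness supplies a compact \<open>L\<close> to cut it down, at the cost of the
  mass outside \<open>L\<close>, which is that of \<open>V - L\<close> since
  \<open>UNIV \<subseteq> V\<close>.\<close>

lemma uniformly_regular_Compl:
  fixes \<M> :: "'a::t2_space measure set"
  assumes "\<M> \<subseteq> borel_probs" and G: "uniformly_regular \<M> G" and T: "uniformly_regular \<M> UNIV"
  shows "uniformly_regular \<M> (- G)"
  unfolding uniformly_regular_def
proof (intro conjI allI impI)
  show "- G \<in> sets borel" using G by (simp add: uniformly_regular_def borel_comp)
  fix e :: real assume "e > 0"
  then have e: "e/2 > 0" by simp
  obtain K U where K: "compact K" "open U" "K \<subseteq> G" "G \<subseteq> U" "\<And>M. M \<in> \<M> \<Longrightarrow> measure M (U - K) \<le> e/2"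
    by (rule uniformly_regularE[OF G e]) (rule that)
  obtain L V where L: "compact L" "open V" "L \<subseteq> UNIV" "UNIV \<subseteq> V" "\<And>M. M \<in> \<M> \<Longrightarrow> measure M (V - L) \<le> e/2"
    by (rule uniformly_regularE[OF T e]) (rule that)
  have "measure M (- K - (L - U)) \<le> e" if "M \<in> \<M>" for M
  proof -
    have "measure M (- K - (L - U)) \<le> measure M (U - K) + measure M (V - L)"
      using that assms(1) K L by (intro measure_borel_le_add) (auto intro: borel_compact)
    then show ?thesis using K(5)[OF that] L(5)[OF that] by simp
  qed
  moreover have "compact (L - U)" "open (- K)"
    using K L by (auto intro: compact_diff compact_imp_closed)
  ultimately show "\<exists>K U. compact K \<and> open U \<and> K \<subseteq> - G \<and> - G \<subseteq> U \<and> (\<forall>M\<in>\<M>. measure M (U - K) \<le> e)"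
    using K L by (intro exI[of _ "L - U"] exI[of _ "- K"]) auto
qed

text \<open>A point of \<open>U \<times> V - K \<times> L\<close> has its first coordinate in
  \<open>U - K\<close> or its second in \<open>V - L\<close>. The error is thus controlled by the
  two marginals, whatever the dependence between the coordinates, and one bound holds for all
  couplings.\<close>

lemma uniformly_regular_Times:
  fixes \<Gamma> :: "('a::polish_space \<times> 'b::polish_space) measure set"
  assumes \<Gamma>: "\<Gamma> \<subseteq> borel_probs"
    and marg: "\<And>M. M \<in> \<Gamma> \<Longrightarrow> distr M borel fst \<in> \<M>" "\<And>M. M \<in> \<Gamma> \<Longrightarrow> distr M borel snd \<in> \<N>"
    and G: "uniformly_regular \<M> G" and H: "uniformly_regular \<N> H"
  shows "uniformly_regular \<Gamma> (G \<times> H)"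
  unfolding uniformly_regular_def
proof (intro conjI allI impI)
  show "G \<times> H \<in> sets borel"
    using G H unfolding borel_prod[symmetric] by (simp add: uniformly_regular_def)
  fix e :: real assume "e > 0"
  then have e: "e/2 > 0" by simp
  obtain K U where K: "compact K" "open U" "K \<subseteq> G" "G \<subseteq> U" "\<And>M. M \<in> \<M> \<Longrightarrow> measure M (U - K) \<le> e/2"
    by (rule uniformly_regularE[OF G e]) (rule that)
  obtain L V where L: "compact L" "open V" "L \<subseteq> H" "H \<subseteq> V" "\<And>M. M \<in> \<N> \<Longrightarrow> measure M (V - L) \<le> e/2"
    by (rule uniformly_regularE[OF H e]) (rule that)
  have KL: "U - K \<in> sets borel" "V - L \<in> sets borel"
    using K L by (auto intro: borel_compact)
  have "measure M (U \<times> V - K \<times> L) \<le> e" if "M \<in> \<Gamma>" for M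
  proof -
    have M: "M \<in> borel_probs" using \<Gamma> that by auto
    note [simp] = borel_probsD(4,5)[OF M]
    have fst: "fst \<in> measurable M borel" and snd: "snd \<in> measurable M borel"
      by (simp_all add: measurable_borel_probs[OF M] borel_measurable_continuous_onI continuous_on_fst continuous_on_snd continuous_on_id)
    have "measure M (U \<times> V - K \<times> L) \<le> measure M (fst -` (U - K) \<inter> space M) + measure M (snd -` (V - L) \<inter> space M)"
      using M KL measurable_sets[OF fst] measurable_sets[OF snd]
      by (intro measure_borel_le_add) auto
    also have "\<dots> = measure (distr M borel fst) (U - K) + measure (distr M borel snd) (V - L)"
      using KL fst snd by (simp add: measure_distr)
    finally show ?thesis using K(5)[OF marg(1)[OF that]] L(5)[OF marg(2)[OF that]] by simp
  qed
  then show "\<exists>K U. compact K \<and> open U \<and> K \<subseteq> G \<times> H \<and> G \<times> H \<subseteq> U \<and> (\<forall>M\<in>\<Gamma>. measure M (U - K) \<le> e)"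
    using K L by (intro exI[of _ "K \<times> L"] exI[of _ "U \<times> V"]) (auto intro: compact_Times open_Times)
qed

text \<open>Unlike for Prokhorov's theorem, uniform regularity of the sets of the algebra makes their
  measures themselves converge, so no boundary condition is needed.\<close>

lemma setwise_compactness:
  fixes M :: "nat \<Rightarrow> 'a::t2_space measure"
  assumes M: "\<And>n. M n \<in> borel_probs"
    and alg: "algebra UNIV \<G>" and count: "countable \<G>" and gen: "sets borel = sigma_sets UNIV \<G>"
    and reg: "\<And>G. G \<in> \<G> \<Longrightarrow> uniformly_regular (range M) G"
  obtains r N where "strict_mono (r :: nat \<Rightarrow> nat)" "N \<in> borel_probs"
    "\<And>G. G \<in> \<G> \<Longrightarrow> (\<lambda>n. measure (M (r n)) G) \<longlonglongrightarrow> measure N G"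
proof -
  interpret algebra UNIV \<G> by fact
  have pM: "prob_space (M n)" for n using M by (rule borel_probsD)
  have Gb: "G \<in> sets borel" if "G \<in> \<G>" for G using reg[OF that] by (simp add: uniformly_regular_def)
  have GM: "G \<in> sets (M n)" if "G \<in> \<G>" for G n using Gb[OF that] borel_probsD(4)[OF M] by simp
  define g where "g = from_nat_into \<G>"
  have ne: "\<G> \<noteq> {}" using empty_sets by blast
  have rg: "range g = \<G>" unfolding g_def using ne count by (rule range_from_nat_into)
  \<comment> \<open>The index \<open>k\<close> runs through the countable algebra; since the
    measures of \<open>g k\<close> lie in the unit interval, each stage can pass to a subsequence
    along which they converge.\<close>
  interpret subseqs "\<lambda>k s. convergent (\<lambda>n. measure (M (s n)) (g k))"
  proof
    fix k and s :: "nat \<Rightarrow> nat"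
    have "bounded (range (\<lambda>n. measure (M (s n)) (g k)))"
      by (rule boundedI[of _ 1]) (auto simp: prob_space.prob_le_1[OF pM])
    from bounded_imp_convergent_subsequence[OF this]
    show "\<exists>r'. strict_mono r' \<and> convergent (\<lambda>n. measure (M ((s \<circ> r') n)) (g k))"
      by (auto simp: convergent_def o_def)
  qed
  have conv: "convergent (\<lambda>n. measure (M (diagseq n)) G)" if "G \<in> \<G>" for G
  proof -
    obtain k where k: "G = g k" using \<open>G \<in> \<G>\<close> rg by (metis imageE)
    \<comment> \<open>From index \<open>Suc k\<close> on, the diagonal sequence is a subsequence of
      the one chosen for \<open>g k\<close>; finitely many earlier terms do not affect
      convergence.\<close>
    have "convergent (\<lambda>n. measure (M ((diagseq \<circ> (+) (Suc k)) n)) (g k))"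
    proof (rule diagseq_holds)
      fix x r and n assume "strict_mono (r::nat\<Rightarrow>nat)" "convergent (\<lambda>m. measure (M (x m)) (g n))"
      then show "convergent (\<lambda>m. measure (M ((x \<circ> r) m)) (g n))"
        unfolding convergent_def using LIMSEQ_subseq_LIMSEQ unfolding o_def by blast
    qed
    then have "convergent (\<lambda>n. measure (M (diagseq (n + Suc k))) G)"
      by (simp add: k o_def add.commute)
    then show ?thesis by (subst (asm) convergent_ignore_initial_segment)
  qed
  define m where "m G = lim (\<lambda>n. measure (M (diagseq n)) G)" for G
  have lim: "(\<lambda>n. measure (M (diagseq n)) G) \<longlonglongrightarrow> m G" if "G \<in> \<G>" for G
    using conv[OF that] by (simp add: m_def convergent_LIMSEQ_iff)
  have m0: "m G \<ge> 0" if "G \<in> \<G>" for G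
    using lim[OF that] by (rule LIMSEQ_le_const) auto
  have madd: "m (A \<union> B) = m A + m B" if "A \<in> \<G>" "B \<in> \<G>" "A \<inter> B = {}" for A B
  proof (rule LIMSEQ_unique)
    show "(\<lambda>n. measure (M (diagseq n)) (A \<union> B)) \<longlonglongrightarrow> m (A \<union> B)" using that by (intro lim) auto
    have "measure (M (diagseq n)) (A \<union> B) = measure (M (diagseq n)) A + measure (M (diagseq n)) B" for n
      using that GM borel_probsD(2)[OF M] by (intro finite_measure.finite_measure_Union) auto
    then show "(\<lambda>n. measure (M (diagseq n)) (A \<union> B)) \<longlonglongrightarrow> m A + m B"
      using that by (auto intro!: tendsto_add lim)
  qed
  \<comment> \<open>The limits form a finitely additive set function with finite values, so
    continuity at the empty set is all that countable additivity requires.\<close>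
  have "\<exists>\<mu> :: 'a set \<Rightarrow> ennreal. (\<forall>s \<in> \<G>. \<mu> s = ennreal (m s)) \<and> measure_space UNIV (sigma_sets UNIV \<G>) \<mu>"
  proof (rule caratheodory_empty_continuous)
    show "positive \<G> (\<lambda>G. ennreal (m G))" by (simp add: positive_def m_def)
    show "additive \<G> (\<lambda>G. ennreal (m G))" by (simp add: additive_def madd m0)
    fix A :: "nat \<Rightarrow> 'a set" assume A: "range A \<subseteq> \<G>" "decseq A" "(\<Inter>i. A i) = {}"
    have AG: "A i \<in> \<G>" for i using A by auto
    have "(\<lambda>i. m (A i)) \<longlonglongrightarrow> 0"
    proof (rule LIMSEQ_I)
      fix e :: real assume e: "e > 0"
      \<comment> \<open>The errors are geometric with total \<open>e / 2\<close>, and uniform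
        regularity makes each compact set independent of \<open>n\<close>.\<close>
      have "\<exists>K. compact K \<and> K \<subseteq> A k \<and> (\<forall>n. measure (M n) (A k - K) \<le> e / 2 * (1/2) ^ Suc k)" for k
      proof -
        obtain K U where "compact K" "open U" "K \<subseteq> A k" "A k \<subseteq> U"
          "\<And>N. N \<in> range M \<Longrightarrow> measure N (U - K) \<le> e / 2 * (1/2) ^ Suc k"
          by (rule uniformly_regularE[OF reg[OF AG], of "e / 2 * (1/2) ^ Suc k"]) (use e in auto)
        moreover have "measure (M n) (A k - K) \<le> measure (M n) (U - K)" for n
          using calculation by (intro measure_borel_mono M) (auto intro: borel_compact)
        ultimately show ?thesis by (meson order_trans rangeI)
      qed
      then obtain K where K: "\<And>k. compact (K k)" "\<And>k. K k \<subseteq> A k"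
        "\<And>k n. measure (M n) (A k - K k) \<le> e / 2 * (1/2) ^ Suc k" by metis
      \<comment> \<open>The \<open>K k\<close> have empty total intersection because the
        \<open>A k\<close> do; by the finite intersection property in \<open>K 0\<close>, finitely
        many of them already have empty intersection.\<close>
      have "\<exists>J. finite J \<and> (\<Inter>k\<in>J. K k) = {}"
      proof (rule ccontr)
        assume J: "\<not> ?thesis"
        have "K 0 \<inter> (\<Inter>k\<in>UNIV. K k) \<noteq> {}"
        proof (rule compact_imp_fip_image)
          show "compact (K 0)" "\<And>i. closed (K i)" using K by (auto intro: compact_imp_closed)
          fix I' :: "nat set" assume "finite I'"
          then show "K 0 \<inter> (\<Inter>i\<in>I'. K i) \<noteq> {}" using J by (metis INT_insert finite_insert)
        qed
        moreover have "(\<Inter>k. K k) \<subseteq> (\<Inter>i. A i)" using K(2) by (intro INF_mono') simp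
        ultimately show False using A(3) by simp
      qed
      then obtain J where J: "finite J" "(\<Inter>k\<in>J. K k) = {}" by blast
      have "\<exists>l. \<forall>k\<in>J. k \<le> l" using J(1) by (simp add: finite_nat_set_iff_bounded_le)
      then obtain l where l: "\<And>k. k \<in> J \<Longrightarrow> k \<le> l" by blast
      have "norm (m (A i) - 0) < e" if "i \<ge> l" for i
      proof -
        have "measure (M n) (A i) \<le> e / 2" for n
        proof -
          interpret M: prob_space "M n" by (rule pM)
          have sK: "A k - K k \<in> sets (M n)" for k
            using Gb[OF AG] K borel_probsD(4)[OF M] by (auto intro: borel_compact)
          \<comment> \<open>For \<open>i\<close> beyond all indices in \<open>J\<close>, each point
            of \<open>A i\<close> is missed by some \<open>K k\<close> with \<open>k\<close> in
            \<open>J\<close>, while it lies in \<open>A k\<close> since the sequence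
            decreases.\<close>
          have "A i \<subseteq> (\<Union>k\<in>J. A k - K k)"
          proof
            fix x assume x: "x \<in> A i"
            obtain k where "k \<in> J" "x \<notin> K k" using J by auto
            moreover have "A i \<subseteq> A k" using A(2) l[OF \<open>k \<in> J\<close>] that by (simp add: decseq_def)
            ultimately show "x \<in> (\<Union>k\<in>J. A k - K k)" using x by auto
          qed
          then have "measure (M n) (A i) \<le> measure (M n) (\<Union>k\<in>J. A k - K k)"
            using sK J by (intro M.finite_measure_mono) auto
          also have "\<dots> \<le> (\<Sum>k\<in>J. measure (M n) (A k - K k))"
            using sK J by (intro M.finite_measure_subadditive_finite) auto
          also have "\<dots> \<le> (\<Sum>k\<in>J. e / 2 * (1/2) ^ Suc k)" by (intro sum_mono K)
          also have "\<dots> \<le> (\<Sum>k. e / 2 * (1/2) ^ Suc k)"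
            using J e sums_mult[OF power_half_series, of "e/2"]
            by (intro sum_le_suminf) (auto simp: sums_iff)
          also have "\<dots> = e / 2" using sums_mult[OF power_half_series, of "e/2"] by (simp add: sums_iff)
          finally show ?thesis .
        qed
        then have "m (A i) \<le> e / 2" by (intro LIMSEQ_le_const2[OF lim[OF AG]]) auto
        then show ?thesis using m0[OF AG, of i] e by simp
      qed
      then show "\<exists>no. \<forall>n\<ge>no. norm (m (A n) - 0) < e" by blast
    qed
    then show "(\<lambda>i. ennreal (m (A i))) \<longlonglongrightarrow> 0" using tendsto_ennrealI by fastforce
  qed simp
  then obtain \<mu> :: "'a set \<Rightarrow> ennreal" where \<mu>: "\<And>G. G \<in> \<G> \<Longrightarrow> \<mu> G = ennreal (m G)"
    and ms: "measure_space UNIV (sigma_sets UNIV \<G>) \<mu>" by blast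
  define N where "N = measure_of UNIV (sigma_sets UNIV \<G>) \<mu>"
  have sN: "sets N = sets borel" by (simp add: N_def gen sigma_sets_sigma_sets_eq)
  have spN: "space N = UNIV" by (simp add: N_def)
  have eN: "emeasure N G = ennreal (m G)" if "G \<in> \<G>" for G
  proof -
    have "emeasure N G = \<mu> G"
      unfolding N_def using ms that
      by (intro emeasure_measure_of_sigma) (auto simp: measure_space_def)
    then show ?thesis using \<mu>[OF that] by simp
  qed
  have mN: "measure N G = m G" if "G \<in> \<G>" for G using eN[OF that] m0[OF that] by (simp add: measure_def)
  have "measure (M n) UNIV = 1" for n
    using prob_space.prob_space[OF pM] borel_probsD(5)[OF M] by simp
  then have "m UNIV = 1" using lim[OF top] by (simp add: LIMSEQ_const_iff)
  then have "prob_space N" using eN[OF top] spN by (intro prob_spaceI) simp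
  then have "N \<in> borel_probs" using sN by (simp add: borel_probs_def)
  then show ?thesis using that[OF subseq_diagseq] mN lim by simp
qed

section \<open>Countable algebras that generate the Borel sets\<close>

text \<open>The closure is reached in countably many stages, each adding complements and binary
  unions and staying countable. The minimality clause serves to transfer a property from
  \<open>B\<close> to \<open>\<G>\<close>: it suffices that the sets with this property form an
  algebra.\<close>

lemma countable_generated_algebra:
  fixes B :: "'a set set"
  assumes "countable B"
  obtains \<G> where "countable \<G>" "algebra UNIV \<G>" "B \<subseteq> \<G>"
    "\<And>\<A>. algebra UNIV \<A> \<Longrightarrow> B \<subseteq> \<A> \<Longrightarrow> \<G> \<subseteq> \<A>"
proof -
  define g where "g = rec_nat (insert {} B) (\<lambda>_ G. G \<union> uminus ` G \<union> (\<lambda>(a, b). a \<union> b) ` (G \<times> G))"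
  have g0: "g 0 = insert {} B" and
    gS: "g (Suc n) = g n \<union> uminus ` g n \<union> (\<lambda>(a, b). a \<union> b) ` (g n \<times> g n)" for n
    by (simp_all add: g_def)
  have mono: "g m \<subseteq> g n" if "m \<le> n" for m n
    using that by (induction rule: dec_induct) (auto simp: gS)
  show ?thesis
  proof
    have "countable (g n)" for n
    proof (induction n)
      case (Suc n)
      then show ?case unfolding gS by (intro countable_Un countable_image countable_SIGMA) auto
    qed (simp add: g0 assms)
    then show "countable (\<Union>n. g n)" by auto
    show "B \<subseteq> (\<Union>n. g n)" using g0 by auto
    show "algebra UNIV (\<Union>n. g n)"
      unfolding algebra_iff_Un
    proof (intro conjI ballI)
      show "{} \<in> (\<Union>n. g n)" using g0 by auto
      fix a assume "a \<in> (\<Union>n. g n)"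
      then obtain i where i: "a \<in> g i" by auto
      have "- a \<in> g (Suc i)" using i by (auto simp: gS)
      then show "UNIV - a \<in> (\<Union>n. g n)" unfolding Compl_eq_Diff_UNIV by blast
      fix b assume "b \<in> (\<Union>n. g n)"
      then obtain j where j: "b \<in> g j" by auto
      have "a \<in> g (max i j)" "b \<in> g (max i j)" using i j mono[of i "max i j"] mono[of j "max i j"] by auto
      then have "a \<union> b \<in> g (Suc (max i j))" unfolding gS by force
      then show "a \<union> b \<in> (\<Union>n. g n)" by blast
    qed simp
    fix \<A> assume "algebra UNIV \<A>" "B \<subseteq> \<A>"
    then interpret algebra UNIV \<A> by simp
    have "g n \<subseteq> \<A>" for n
    proof (induction n)
      case 0
      then show ?case using \<open>B \<subseteq> \<A>\<close> by (simp add: g0)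
    next
      case (Suc n)
      then show ?case using compl_sets by (auto simp: gS Compl_eq_Diff_UNIV)
    qed
    then show "(\<Union>n. g n) \<subseteq> \<A>" by blast
  qed
qed

lemma sigma_sets_eq_borelI:
  assumes "countable B" "topological_basis B" "B \<subseteq> \<G>" "\<G> \<subseteq> sets borel"
  shows "sigma_sets UNIV \<G> = sets borel"
proof
  show "sigma_sets UNIV \<G> \<subseteq> sets borel"
    using sets.sigma_sets_subset[OF assms(4)] by simp
  have "sets borel = sigma_sets UNIV B"
    by (subst borel_eq_countable_basis[OF assms(1,2)]) simp
  also have "\<dots> \<subseteq> sigma_sets UNIV \<G>" by (rule sigma_sets_mono') fact
  finally show "sets borel \<subseteq> sigma_sets UNIV \<G>" .
qed

lemma borel_probs_eqI:
  assumes M: "M \<in> borel_probs" and N: "N \<in> borel_probs" and "Int_stable \<G>" "UNIV \<in> \<G>"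
    and gen: "sigma_sets UNIV \<G> = sets borel"
    and eq: "\<And>G. G \<in> \<G> \<Longrightarrow> measure M G = measure N G"
  shows "M = N"
proof (rule measure_eqI_generator_eq[where E=\<G> and \<Omega>=UNIV and A="\<lambda>_. UNIV"])
  interpret M: prob_space M by (rule borel_probsD[OF M])
  interpret N: prob_space N by (rule borel_probsD[OF N])
  show "emeasure M X = emeasure N X" if "X \<in> \<G>" for X
    using eq[OF that] by (simp add: M.emeasure_eq_measure N.emeasure_eq_measure)
  show "emeasure M UNIV \<noteq> \<infinity>" by simp
qed (use assms in \<open>simp_all add: borel_probsD\<close>)

lemma algebra_Int_stable: "algebra \<Omega> \<G> \<Longrightarrow> Int_stable \<G>"
  by (auto simp: Int_stable_def algebra_iff_Int)

lemma algebra_UNIV: "algebra UNIV \<G> \<Longrightarrow> UNIV \<in> \<G>"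
  using algebra.top by blast

text \<open>A countable base inside the algebra makes every open set an increasing union of members
  of the algebra; this later turns setwise convergence into bounds on open sets.\<close>

lemma countable_borel_algebra:
  obtains \<A> B where "countable \<A>" "algebra UNIV \<A>" "countable B"
    "topological_basis (B :: 'a::second_countable_topology set set)" "B \<subseteq> \<A>" "\<A> \<subseteq> sets borel"
proof -
  obtain B :: "'a set set" where B: "countable B" "topological_basis B"
    using ex_countable_basis by blast
  obtain \<A> where A: "countable \<A>" "algebra UNIV \<A>" "B \<subseteq> \<A>"
    "\<And>\<A>'. algebra UNIV \<A>' \<Longrightarrow> B \<subseteq> \<A>' \<Longrightarrow> \<A> \<subseteq> \<A>'"
    using countable_generated_algebra[OF B(1)] by blast
  have "algebra UNIV (sets borel)" using sets.algebra_axioms[of borel] by simp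
  from A(4)[OF this] have "\<A> \<subseteq> sets borel" using topological_basis_open[OF B(2)] by (simp add: subset_iff)
  then show ?thesis using that A B by blast
qed

section \<open>Lower semicontinuity\<close>

text \<open>Layer-cake formula: \<open>f x\<close> is the length of the interval
  \<open>{0<..<f x}\<close>, and the two integrations are exchanged. The strict inequality matters,
  as it makes the superlevel sets of a continuous function open.\<close>

lemma nn_integral_eq_nn_integral_tail:
  assumes "sigma_finite_measure M" and [measurable]: "f \<in> borel_measurable M" and nn: "\<And>x. 0 \<le> f x"
  shows "(\<integral>\<^sup>+x. ennreal (f x) \<partial>M) = (\<integral>\<^sup>+t. indicator {0<..} t * emeasure M {x\<in>space M. t < f x} \<partial>lborel)"
proof -
  interpret sigma_finite_measure M by fact
  interpret P: pair_sigma_finite lborel M ..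
  have "ennreal (f x) = (\<integral>\<^sup>+t. indicator {0<..} t * indicator {x\<in>space M. t < f x} x \<partial>lborel)"
    if "x \<in> space M" for x
  proof -
    have "ennreal (f x) = (\<integral>\<^sup>+t. indicator {0<..<f x} t \<partial>lborel)" using nn[of x] by simp
    also have "\<dots> = (\<integral>\<^sup>+t. indicator {0<..} t * indicator {x\<in>space M. t < f x} x \<partial>lborel)"
      using that by (intro nn_integral_cong) (auto split: split_indicator)
    finally show ?thesis .
  qed
  then have "(\<integral>\<^sup>+x. ennreal (f x) \<partial>M)
      = (\<integral>\<^sup>+x. (\<integral>\<^sup>+t. indicator {0<..} t * indicator {x\<in>space M. t < f x} x \<partial>lborel) \<partial>M)"
    by (intro nn_integral_cong) simp
  also have "\<dots> = (\<integral>\<^sup>+t. (\<integral>\<^sup>+x. indicator {0<..} t * indicator {x\<in>space M. t < f x} x \<partial>M) \<partial>lborel)"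
    by (rule P.Fubini') measurable
  also have "\<dots> = (\<integral>\<^sup>+t. indicator {0<..} t * emeasure M {x\<in>space M. t < f x} \<partial>lborel)"
    by (intro nn_integral_cong) (subst nn_integral_cmult, simp_all)
  finally show ?thesis .
qed

text \<open>This is the open-set inequality of the portmanteau theorem. On finite unions of base
  sets the measures converge, and such unions exhaust \<open>U\<close> from below.\<close>

lemma setwise_limit_open:
  fixes M :: "nat \<Rightarrow> 'a::topological_space measure"
  assumes M: "\<And>n. M n \<in> borel_probs" and N: "N \<in> borel_probs"
    and alg: "algebra UNIV \<G>" and B: "countable B" "topological_basis B" "B \<subseteq> \<G>"
    and lim: "\<And>G. G \<in> \<G> \<Longrightarrow> (\<lambda>n. measure (M n) G) \<longlonglongrightarrow> measure N G"
    and U: "open U"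
  shows "emeasure N U \<le> liminf (\<lambda>n. emeasure (M n) U)"
proof -
  interpret algebra UNIV \<G> by fact
  obtain B' where B': "B' \<subseteq> B" "\<Union>B' = U"
    using B(2) U unfolding topological_basis_def by meson
  \<comment> \<open>The empty set is added so that an enumeration exists even if \<open>B'\<close>
    is empty.\<close>
  define b where "b = from_nat_into (insert {} B')"
  have rb: "range b = insert {} B'"
    unfolding b_def using B' B(1) by (intro range_from_nat_into) (auto intro: countable_subset)
  have bG: "b i \<in> \<G>" for i using rb B' B(3) by (metis empty_sets insert_iff rangeI subset_iff)
  have bo: "open (b i)" for i using rb B' B(2) by (metis insert_iff open_empty rangeI subset_iff topological_basis_open)
  define A where "A i = (\<Union>k\<le>i. b k)" for i
  have AG: "A i \<in> \<G>" for i unfolding A_def by (intro finite_UN) (auto simp: bG)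
  have Ao: "open (A i)" for i using bo by (auto simp: A_def)
  have U_eq: "(\<Union>i. A i) = U"
  proof -
    have "(\<Union>i. A i) = \<Union>(range b)" by (auto simp: A_def)
    then show ?thesis using B' by (simp add: rb)
  qed
  have inc: "incseq A" by (intro monoI) (fastforce simp: A_def)
  have s: "range A \<subseteq> sets N" using Ao by (auto simp: borel_probsD[OF N])
  have "emeasure N U = (SUP i. emeasure N (A i))"
    using SUP_emeasure_incseq[OF s inc] U_eq by simp
  also have "\<dots> \<le> liminf (\<lambda>n. emeasure (M n) U)"
  proof (rule SUP_least)
    fix i
    have "(\<lambda>n. emeasure (M n) (A i)) \<longlonglongrightarrow> emeasure N (A i)"
      using lim[OF AG] by (simp add: finite_measure.emeasure_eq_measure[OF borel_probsD(2)[OF M]]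
        finite_measure.emeasure_eq_measure[OF borel_probsD(2)[OF N]])
    then have "emeasure N (A i) = liminf (\<lambda>n. emeasure (M n) (A i))"
      by (intro lim_imp_Liminf[symmetric]) auto
    also have "\<dots> \<le> liminf (\<lambda>n. emeasure (M n) U)"
      using U_eq U by (intro Liminf_mono always_eventually allI emeasure_mono) (auto simp: borel_probsD[OF M])
    finally show "emeasure N (A i) \<le> liminf (\<lambda>n. emeasure (M n) U)" .
  qed
  finally show ?thesis .
qed

text \<open>The layer-cake formula reduces the claim to open superlevel sets, and Fatou's lemma in
  \<open>t\<close> takes the lower limit out of the integral, so unbounded costs are
  covered.\<close>

lemma nn_integral_le_liminf:
  fixes M :: "nat \<Rightarrow> 'a::topological_space measure" and f :: "'a \<Rightarrow> real"
  assumes M: "\<And>n. M n \<in> borel_probs" and N: "N \<in> borel_probs"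
    and le: "\<And>U. open U \<Longrightarrow> emeasure N U \<le> liminf (\<lambda>n. emeasure (M n) U)"
    and f: "continuous_on UNIV f" "\<And>x. 0 \<le> f x"
  shows "(\<integral>\<^sup>+x. ennreal (f x) \<partial>N) \<le> liminf (\<lambda>n. \<integral>\<^sup>+x. ennreal (f x) \<partial>M n)"
proof -
  have fb: "f \<in> borel_measurable borel" using f(1) by (rule borel_measurable_continuous_onI)
  have fm: "f \<in> borel_measurable K" if "K \<in> borel_probs" for K
    using fb by (simp add: measurable_borel_probs[OF that])
  let ?I = "\<lambda>K t. indicator {0<..} t * emeasure K {x\<in>space K. t < f x} :: ennreal"
  have meas: "?I K \<in> borel_measurable lborel" if K: "K \<in> borel_probs" for K
  proof -
    interpret sigma_finite_measure K by (rule borel_probsD[OF K])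
    note [measurable] = fm[OF K]
    \<comment> \<open>The measure of a superlevel set is the measure of a section of a product set,
      hence measurable in \<open>t\<close>.\<close>
    have "(\<lambda>t. emeasure K (Pair t -` {(t, x). x \<in> space K \<and> t < f x})) \<in> borel_measurable lborel"
    proof (rule measurable_emeasure_Pair)
      have "{p\<in>space (lborel \<Otimes>\<^sub>M K). fst p < f (snd p)} \<in> sets (lborel \<Otimes>\<^sub>M K)" by measurable
      also have "{p\<in>space (lborel \<Otimes>\<^sub>M K). fst p < f (snd p)} = {(t, x). x \<in> space K \<and> t < f x}"
        by (auto simp: space_pair_measure)
      finally show "{(t, x). x \<in> space K \<and> t < f x} \<in> sets (lborel \<Otimes>\<^sub>M K)" .
    qed
    then show ?thesis by (simp add: vimage_def)
  qed
  have "(\<integral>\<^sup>+x. ennreal (f x) \<partial>N) = (\<integral>\<^sup>+t. ?I N t \<partial>lborel)"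
    by (intro nn_integral_eq_nn_integral_tail borel_probsD[OF N] fm N f)
  also have "\<dots> \<le> (\<integral>\<^sup>+t. liminf (\<lambda>n. ?I (M n) t) \<partial>lborel)"
  proof (rule nn_integral_mono)
    fix t
    have "open {x. t < f x}" using f(1) by (intro open_Collect_less) auto
    from le[OF this] show "?I N t \<le> liminf (\<lambda>n. ?I (M n) t)"
      by (cases "0 < t") (simp_all add: borel_probsD[OF N] borel_probsD[OF M])
  qed
  also have "\<dots> \<le> liminf (\<lambda>n. \<integral>\<^sup>+t. ?I (M n) t \<partial>lborel)"
    by (intro nn_integral_liminf meas M)
  also have "(\<lambda>n. \<integral>\<^sup>+t. ?I (M n) t \<partial>lborel) = (\<lambda>n. \<integral>\<^sup>+x. ennreal (f x) \<partial>M n)"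
    by (intro ext nn_integral_eq_nn_integral_tail[symmetric] borel_probsD(3)[OF M] fm M f)
  finally show ?thesis .
qed

lemma algebra_uniformly_regular:
  fixes \<M> :: "'a::t2_space measure set"
  assumes "\<M> \<subseteq> borel_probs" "uniformly_regular \<M> UNIV"
  shows "algebra UNIV (Collect (uniformly_regular \<M>))"
  unfolding algebra_iff_Un
  using uniformly_regular_Un[OF assms(1)] uniformly_regular_Compl[OF assms(1) _ assms(2)]
    uniformly_regular_Compl[OF assms(1) assms(2) assms(2)]
  by (auto simp: Compl_eq_Diff_UNIV)

lemma pair_borel_probs:
  fixes M :: "'a::second_countable_topology measure" and N :: "'b::second_countable_topology measure"
  assumes M: "M \<in> borel_probs" and N: "N \<in> borel_probs"
  shows "M \<Otimes>\<^sub>M N \<in> borel_probs"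
proof -
  have "sets (M \<Otimes>\<^sub>M N) = sets (borel \<Otimes>\<^sub>M borel)"
    by (intro sets_pair_measure_cong borel_probsD M N)
  also have "\<dots> = sets borel" by (subst borel_prod) simp
  finally show ?thesis
    using prob_space_pair[OF borel_probsD(1)[OF M] borel_probsD(1)[OF N]]
    by (simp add: borel_probs_def)
qed

lemma distr_borel_pair_fst:
  assumes M: "M \<in> borel_probs" and N: "N \<in> borel_probs"
  shows "distr (M \<Otimes>\<^sub>M N) borel fst = M"
proof -
  interpret N: prob_space N by (rule borel_probsD[OF N])
  have "distr (M \<Otimes>\<^sub>M N) borel fst = distr (M \<Otimes>\<^sub>M N) M fst"
    by (intro distr_cong) (simp_all add: borel_probsD[OF M])
  then show ?thesis by (simp add: N.distr_pair_fst N.emeasure_space_1 flip: scale_measure_1)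
qed

lemma distr_borel_pair_snd:
  fixes M :: "'a::second_countable_topology measure" and N :: "'b::second_countable_topology measure"
  assumes M: "M \<in> borel_probs" and N: "N \<in> borel_probs"
  shows "distr (M \<Otimes>\<^sub>M N) borel snd = N"
proof (rule measure_eqI)
  interpret M: prob_space M by (rule borel_probsD[OF M])
  interpret N: prob_space N by (rule borel_probsD[OF N])
  show "sets (distr (M \<Otimes>\<^sub>M N) borel snd) = sets N" by (simp add: borel_probsD[OF N])
  fix A assume "A \<in> sets (distr (M \<Otimes>\<^sub>M N) borel snd)"
  then have A: "A \<in> sets N" by (simp add: borel_probsD[OF N])
  have "snd \<in> measurable (M \<Otimes>\<^sub>M N) borel"
    using measurable_snd[of M N] by (simp add: measurable_cong_sets[OF refl borel_probsD(4)[OF N]])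
  moreover have "snd -` A \<inter> space (M \<Otimes>\<^sub>M N) = space M \<times> A"
    using sets.sets_into_space[OF A] by (auto simp: space_pair_measure)
  ultimately show "emeasure (distr (M \<Otimes>\<^sub>M N) borel snd) A = emeasure N A"
    using A by (simp add: emeasure_distr borel_probsD[OF N] N.emeasure_pair_measure_Times M.emeasure_space_1)
qed

text \<open>Both marginals of the square of \<open>M n\<close> are \<open>M n\<close>, so uniform
  regularity on \<open>\<G>\<close> passes to rectangles and compactness applies once more. The test
  functions are quantified inside the conclusion because one subsequence has to serve them
  all.\<close>

lemma setwise_limit_pair:
  fixes M :: "nat \<Rightarrow> 'a::polish_space measure"
  assumes M: "\<And>n. M n \<in> borel_probs" and N: "N \<in> borel_probs"
    and G: "countable \<G>" "algebra UNIV \<G>" "\<And>G. G \<in> \<G> \<Longrightarrow> uniformly_regular (range M) G"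
    and B: "countable B" "topological_basis B" "B \<subseteq> \<G>"
    and lim: "\<And>G. G \<in> \<G> \<Longrightarrow> (\<lambda>n. measure (M n) G) \<longlonglongrightarrow> measure N G"
  obtains s where "strict_mono s"
    "\<forall>f. continuous_on UNIV f \<longrightarrow> (\<forall>x. 0 \<le> f x) \<longrightarrow>
      (\<integral>\<^sup>+x. ennreal (f x) \<partial>(N \<Otimes>\<^sub>M N)) \<le> liminf (\<lambda>n. \<integral>\<^sup>+x. ennreal (f x) \<partial>(M (s n) \<Otimes>\<^sub>M M (s n)))"
proof -
  let ?P = "\<lambda>n. M n \<Otimes>\<^sub>M M n"
  let ?E = "(\<lambda>(a, b). a \<times> b) ` (\<G> \<times> \<G>)"
  let ?B = "(\<lambda>(a, b). a \<times> b) ` (B \<times> B)"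
  have P: "?P n \<in> borel_probs" for n by (intro pair_borel_probs M)
  have NN: "N \<Otimes>\<^sub>M N \<in> borel_probs" by (intro pair_borel_probs N)
  have UNIV: "UNIV \<in> \<G>" using G(2) by (rule algebra_UNIV)
  have regE: "uniformly_regular (range ?P) (a \<times> b)" if "a \<in> \<G>" "b \<in> \<G>" for a b
    using P by (intro uniformly_regular_Times[OF _ _ _ G(3)[OF that(1)] G(3)[OF that(2)]])
      (auto simp: distr_borel_pair_fst[OF M M] distr_borel_pair_snd[OF M M])
  have rP: "range ?P \<subseteq> borel_probs" using P by auto
  have EU: "UNIV \<in> ?E" using UNIV by (auto intro!: image_eqI[of _ _ "(UNIV, UNIV)"])
  have algR: "algebra UNIV (Collect (uniformly_regular (range ?P)))"
    using regE[OF UNIV UNIV] by (intro algebra_uniformly_regular rP) simp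
  have "countable ?E" using G(1) by auto
  then obtain \<H> where H: "countable \<H>" "algebra UNIV \<H>" "?E \<subseteq> \<H>"
    and min: "\<And>\<A>. algebra UNIV \<A> \<Longrightarrow> ?E \<subseteq> \<A> \<Longrightarrow> \<H> \<subseteq> \<A>"
    using countable_generated_algebra by blast
  have reg: "uniformly_regular (range ?P) h" if "h \<in> \<H>" for h
  proof -
    have "?E \<subseteq> Collect (uniformly_regular (range ?P))" using regE by auto
    from min[OF algR this] that show ?thesis by auto
  qed
  have basis: "countable ?B" "topological_basis ?B"
    using B by (auto intro: topological_basis_prod)
  have BE: "?B \<subseteq> ?E" using B(3) by auto
  have Hb: "\<H> \<subseteq> sets borel" using reg by (auto simp: uniformly_regular_def)
  have gen: "sets borel = sigma_sets UNIV \<H>"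
    using BE H(3) Hb by (intro sigma_sets_eq_borelI[OF basis, symmetric]) auto
  obtain s K where s: "strict_mono s" and K: "K \<in> borel_probs"
    and limK: "\<And>h. h \<in> \<H> \<Longrightarrow> (\<lambda>n. measure (?P (s n)) h) \<longlonglongrightarrow> measure K h"
    by (rule setwise_compactness[of ?P \<H>, OF P H(2,1) gen reg]) ((rule that, assumption+) | assumption)+
  \<comment> \<open>Rectangles are stable under intersection and generate the Borel sets, and the
    mass of a rectangle under a square is a product of two convergent sequences; this identifies the
    limit.\<close>
  have "K = N \<Otimes>\<^sub>M N"
  proof (rule borel_probs_eqI[OF K NN, of ?E])
    show "Int_stable ?E"
    proof (rule Int_stableI_image)
      fix p q assume "p \<in> \<G> \<times> \<G>" "q \<in> \<G> \<times> \<G>"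
      then show "\<exists>r\<in>\<G> \<times> \<G>. (\<lambda>(a, b). a \<times> b) p \<inter> (\<lambda>(a, b). a \<times> b) q = (\<lambda>(a, b). a \<times> b) r"
        using G(2) by (intro bexI[of _ "(fst p \<inter> fst q, snd p \<inter> snd q)"]) (auto simp: algebra_iff_Int)
    qed
    show "UNIV \<in> ?E" by (rule EU)
    show "sigma_sets UNIV ?E = sets borel"
      using H(3) Hb by (intro sigma_sets_eq_borelI[OF basis BE]) auto
    fix h assume "h \<in> ?E"
    then obtain a b where h: "h = a \<times> b" "a \<in> \<G>" "b \<in> \<G>" by auto
    then have "a \<in> sets borel" "b \<in> sets borel" using G(3) by (auto simp: uniformly_regular_def)
    then have prod: "measure (L \<Otimes>\<^sub>M L) h = measure L a * measure L b" if "L \<in> borel_probs" for L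
      using that unfolding h
      by (simp add: measure_def borel_probsD enn2real_mult sigma_finite_measure.emeasure_pair_measure_Times)
    have sub: "(\<lambda>n. measure (M (s n)) c) \<longlonglongrightarrow> measure N c" if "c \<in> \<G>" for c
      using LIMSEQ_subseq_LIMSEQ[OF lim[OF that] s] by (simp add: o_def)
    show "measure K h = measure (N \<Otimes>\<^sub>M N) h"
    proof (rule LIMSEQ_unique)
      show "(\<lambda>n. measure (?P (s n)) h) \<longlonglongrightarrow> measure K h" using limK H(3) \<open>h \<in> ?E\<close> by blast
      show "(\<lambda>n. measure (?P (s n)) h) \<longlonglongrightarrow> measure (N \<Otimes>\<^sub>M N) h"
        unfolding prod[OF M] prod[OF N]
        by (rule tendsto_mult[OF sub[OF h(2)] sub[OF h(3)]])
    qed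
  qed
  then have limN: "(\<lambda>n. measure (?P (s n)) h) \<longlonglongrightarrow> measure (N \<Otimes>\<^sub>M N) h" if "h \<in> \<H>" for h
    using limK that by simp
  show ?thesis
  proof (rule that[OF s], intro allI impI)
    fix f :: "'a \<times> 'a \<Rightarrow> real" assume f: "continuous_on UNIV f" "\<forall>x. 0 \<le> f x"
    have "?B \<subseteq> \<H>" using BE H(3) by (rule order_trans)
    note op = setwise_limit_open[of "\<lambda>n. ?P (s n)", OF P NN H(2) basis this limN]
    show "(\<integral>\<^sup>+x. ennreal (f x) \<partial>(N \<Otimes>\<^sub>M N)) \<le> liminf (\<lambda>n. \<integral>\<^sup>+x. ennreal (f x) \<partial>(?P (s n)))"
      by (rule nn_integral_le_liminf[of "\<lambda>n. ?P (s n)", OF P NN op f(1) spec[OF f(2)]])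
  qed
qed

section \<open>Optimal couplings\<close>

lemma couplingsD:
  assumes "\<pi> \<in> couplings \<mu> \<nu>"
  shows "sets \<pi> = sets borel" "distr \<pi> borel fst = \<mu>" "distr \<pi> borel snd = \<nu>"
  using assms by (auto simp: couplings_def)

lemma couplings_borel_probs:
  fixes \<mu> :: "'a::topological_space measure" and \<nu> :: "'b::topological_space measure"
  assumes \<mu>: "\<mu> \<in> borel_probs" and \<pi>: "\<pi> \<in> couplings \<mu> \<nu>"
  shows "\<pi> \<in> borel_probs"
proof -
  note \<pi> = couplingsD[OF \<pi>]
  have "fst \<in> measurable \<pi> (borel :: 'a measure)"
    by (simp add: measurable_cong_sets[OF \<pi>(1) refl] borel_measurable_continuous_onI continuous_on_fst continuous_on_id)
  moreover have "prob_space (distr \<pi> borel fst)" using borel_probsD(1)[OF \<mu>] \<pi>(2) by simp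
  ultimately have "prob_space \<pi>" by (rule prob_space_distrD)
  then show ?thesis using \<pi>(1) by (simp add: borel_probs_def)
qed

lemma pair_in_couplings:
  fixes \<mu> :: "'a::second_countable_topology measure" and \<nu> :: "'b::second_countable_topology measure"
  assumes "\<mu> \<in> borel_probs" "\<nu> \<in> borel_probs"
  shows "\<mu> \<Otimes>\<^sub>M \<nu> \<in> couplings \<mu> \<nu>"
  using borel_probsD(4)[OF pair_borel_probs[OF assms]] distr_borel_pair_fst[OF assms] distr_borel_pair_snd[OF assms]
  by (simp add: couplings_def)

lemma measurable_fst_borel: "\<pi> \<in> borel_probs \<Longrightarrow> fst \<in> borel_measurable \<pi>"
  and measurable_snd_borel: "\<pi> \<in> borel_probs \<Longrightarrow> snd \<in> borel_measurable \<pi>"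
  by (simp_all add: measurable_borel_probs borel_measurable_continuous_onI continuous_on_fst
    continuous_on_snd continuous_on_id)

lemma measure_couplings:
  fixes \<mu> :: "'a::topological_space measure" and \<nu> :: "'b::topological_space measure"
  assumes \<pi>: "\<pi> \<in> couplings \<mu> \<nu>" "\<pi> \<in> borel_probs"
  shows "A \<in> sets borel \<Longrightarrow> measure \<pi> (A \<times> UNIV) = measure \<mu> A"
    and "B \<in> sets borel \<Longrightarrow> measure \<pi> (UNIV \<times> B) = measure \<nu> B"
proof -
  have "A \<times> UNIV = fst -` A" "UNIV \<times> B = snd -` B" for A :: "'a set" and B :: "'b set" by auto
  then show "A \<in> sets borel \<Longrightarrow> measure \<pi> (A \<times> UNIV) = measure \<mu> A"
    "B \<in> sets borel \<Longrightarrow> measure \<pi> (UNIV \<times> B) = measure \<nu> B"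
    using couplingsD[OF \<pi>(1)] borel_probsD(5)[OF \<pi>(2)] measurable_fst_borel[OF \<pi>(2)] measurable_snd_borel[OF \<pi>(2)]
    by (metis inf_top_right measure_distr)+
qed

text \<open>Setwise limits are known on an algebra only; agreement of the marginals on generating
  algebras is enough to identify them.\<close>

lemma couplingsI:
  fixes \<mu> :: "'a::second_countable_topology measure" and \<nu> :: "'b::second_countable_topology measure"
  assumes \<mu>: "\<mu> \<in> borel_probs" and \<nu>: "\<nu> \<in> borel_probs" and \<pi>: "\<pi> \<in> borel_probs"
    and A: "algebra UNIV \<A>" "sigma_sets UNIV \<A> = sets borel"
    and B: "algebra UNIV \<B>" "sigma_sets UNIV \<B> = sets borel"
    and eq: "\<And>a. a \<in> \<A> \<Longrightarrow> measure \<pi> (a \<times> UNIV) = measure \<mu> a"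
      "\<And>b. b \<in> \<B> \<Longrightarrow> measure \<pi> (UNIV \<times> b) = measure \<nu> b"
  shows "\<pi> \<in> couplings \<mu> \<nu>"
proof -
  interpret prob_space \<pi> by (rule borel_probsD[OF \<pi>])
  have d: "distr \<pi> borel fst \<in> borel_probs" "distr \<pi> borel snd \<in> borel_probs"
    unfolding borel_probs_def using measurable_fst_borel[OF \<pi>] measurable_snd_borel[OF \<pi>]
    by (auto intro: prob_space_distr)
  have c: "\<pi> \<in> couplings (distr \<pi> borel fst) (distr \<pi> borel snd)"
    by (simp add: couplings_def borel_probsD[OF \<pi>])
  have sub: "\<A> \<subseteq> sets borel" "\<B> \<subseteq> sets borel" using A(2) B(2) by (auto intro: sigma_sets.Basic)
  have "distr \<pi> borel fst = \<mu>"
    using sub eq(1) measure_couplings(1)[OF c \<pi>]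
    by (intro borel_probs_eqI[OF d(1) \<mu> algebra_Int_stable[OF A(1)] algebra_UNIV[OF A(1)] A(2)]) (metis subsetD)
  moreover have "distr \<pi> borel snd = \<nu>"
    using sub eq(2) measure_couplings(2)[OF c \<pi>]
    by (intro borel_probs_eqI[OF d(2) \<nu> algebra_Int_stable[OF B(1)] algebra_UNIV[OF B(1)] B(2)]) (metis subsetD)
  ultimately show ?thesis using borel_probsD(4)[OF \<pi>] by (simp add: couplings_def)
qed

text \<open>Regularity of \<open>\<mu>\<close> and \<open>\<nu>\<close> controls all rectangles at
  once. Two extractions are made: one along which the couplings converge, and a further one along
  which their squares do.\<close>

lemma couplings_limit:
  fixes \<mu> :: "'a::polish_space measure" and \<nu> :: "'b::polish_space measure"
    and M :: "nat \<Rightarrow> ('a \<times> 'b) measure"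
  assumes \<mu>: "\<mu> \<in> borel_probs" and \<nu>: "\<nu> \<in> borel_probs" and M: "\<And>n. M n \<in> couplings \<mu> \<nu>"
  obtains s \<pi> where "strict_mono s" "\<pi> \<in> couplings \<mu> \<nu>"
    "\<forall>f. continuous_on UNIV f \<longrightarrow> (\<forall>x. 0 \<le> f x) \<longrightarrow>
      (\<integral>\<^sup>+x. ennreal (f x) \<partial>(\<pi> \<Otimes>\<^sub>M \<pi>)) \<le> liminf (\<lambda>n. \<integral>\<^sup>+x. ennreal (f x) \<partial>(M (s n) \<Otimes>\<^sub>M M (s n)))"
proof -
  have Mb: "M n \<in> borel_probs" for n using couplings_borel_probs[OF \<mu> M] .
  obtain \<A> and A :: "'a set set" where A: "countable \<A>" "algebra UNIV \<A>" "countable A"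
    "topological_basis A" "A \<subseteq> \<A>" "\<A> \<subseteq> sets borel" by (rule countable_borel_algebra)
  obtain \<B> and B :: "'b set set" where B: "countable \<B>" "algebra UNIV \<B>" "countable B"
    "topological_basis B" "B \<subseteq> \<B>" "\<B> \<subseteq> sets borel" by (rule countable_borel_algebra)
  let ?E = "(\<lambda>(a, b). a \<times> b) ` (\<A> \<times> \<B>)"
  let ?B = "(\<lambda>(a, b). a \<times> b) ` (A \<times> B)"
  have UNIV: "UNIV \<in> \<A>" "UNIV \<in> \<B>" using A(2) B(2) by (auto intro: algebra_UNIV)
  have "countable ?E" using A(1) B(1) by auto
  then obtain \<G> where G: "countable \<G>" "algebra UNIV \<G>" "?E \<subseteq> \<G>"
    and min: "\<And>\<C>. algebra UNIV \<C> \<Longrightarrow> ?E \<subseteq> \<C> \<Longrightarrow> \<G> \<subseteq> \<C>"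
    using countable_generated_algebra by blast
  have regE: "uniformly_regular (range M) (a \<times> b)" if "a \<in> \<A>" "b \<in> \<B>" for a b
    using that A(6) B(6) Mb couplingsD[OF M]
    by (intro uniformly_regular_Times[of _ "{\<mu>}" "{\<nu>}"] uniformly_regular_singleton \<mu> \<nu>) auto
  have "algebra UNIV (Collect (uniformly_regular (range M)))"
    using regE[OF UNIV] Mb by (intro algebra_uniformly_regular) auto
  moreover have "?E \<subseteq> Collect (uniformly_regular (range M))" using regE by auto
  ultimately have "\<G> \<subseteq> Collect (uniformly_regular (range M))" by (rule min)
  then have reg: "uniformly_regular (range M) g" if "g \<in> \<G>" for g using that by auto
  then have Gb: "\<G> \<subseteq> sets borel" by (auto simp: uniformly_regular_def)
  have basis: "countable ?B" "topological_basis ?B"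
    using A B by (auto intro: topological_basis_prod)
  have "?B \<subseteq> ?E" using A(5) B(5) by auto
  then have BG: "?B \<subseteq> \<G>" using G(3) by (rule order_trans)
  note gen = sigma_sets_eq_borelI[OF basis BG Gb, symmetric]
  obtain r N where r: "strict_mono r" and N: "N \<in> borel_probs"
    and lim: "\<And>g. g \<in> \<G> \<Longrightarrow> (\<lambda>n. measure (M (r n)) g) \<longlonglongrightarrow> measure N g"
    by (rule setwise_compactness[of M \<G>, OF Mb G(2,1) gen reg]) (assumption | rule that)+
  \<comment> \<open>Along couplings the masses of the cylinders \<open>a \<times> UNIV\<close> and
    \<open>UNIV \<times> b\<close> are constant, so the limit inherits the marginals.\<close>
  have "N \<in> couplings \<mu> \<nu>"
  proof (rule couplingsI[OF \<mu> \<nu> N A(2) sigma_sets_eq_borelI[OF A(3-6)] B(2) sigma_sets_eq_borelI[OF B(3-6)]])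
    fix a assume a: "a \<in> \<A>"
    have "a \<times> UNIV \<in> \<G>" using G(3) a UNIV by auto
    from lim[OF this] have "(\<lambda>n. measure \<mu> a) \<longlonglongrightarrow> measure N (a \<times> UNIV)"
      using a A(6) by (simp add: measure_couplings[OF M Mb] subset_iff)
    then show "measure N (a \<times> UNIV) = measure \<mu> a" by (simp add: LIMSEQ_const_iff)
  next
    fix b assume b: "b \<in> \<B>"
    have "UNIV \<times> b \<in> \<G>" using G(3) b UNIV by auto
    from lim[OF this] have "(\<lambda>n. measure \<nu> b) \<longlonglongrightarrow> measure N (UNIV \<times> b)"
      using b B(6) by (simp add: measure_couplings[OF M Mb] subset_iff)
    then show "measure N (UNIV \<times> b) = measure \<nu> b" by (simp add: LIMSEQ_const_iff)
  qed
  moreover have "uniformly_regular (range (\<lambda>n. M (r n))) g" if "g \<in> \<G>" for g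
    using reg[OF that] by (rule uniformly_regular_subset) auto
  then obtain s where "strict_mono s"
    "\<forall>f. continuous_on UNIV f \<longrightarrow> (\<forall>x. 0 \<le> f x) \<longrightarrow>
      (\<integral>\<^sup>+x. ennreal (f x) \<partial>(N \<Otimes>\<^sub>M N)) \<le> liminf (\<lambda>n. \<integral>\<^sup>+x. ennreal (f x) \<partial>(M (r (s n)) \<Otimes>\<^sub>M M (r (s n))))"
    by (rule setwise_limit_pair[of "\<lambda>n. M (r n)" N \<G>, OF Mb N G(1,2) _ basis BG lim])
      (assumption | rule that)+
  moreover have "strict_mono (r \<circ> s)" using r calculation(2) by (rule strict_mono_o)
  ultimately show ?thesis using that[of "r \<circ> s" N] by simp
qed

text \<open>Direct method: a minimizing sequence, a limit of its squares, lower semicontinuity. The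
  product measure shows that there is a coupling to start from.\<close>

lemma exists_optimal_coupling:
  fixes \<mu> :: "'a::polish_space measure" and \<nu> :: "'b::polish_space measure"
    and c :: "'a \<times> 'b \<Rightarrow> 'a \<times> 'b \<Rightarrow> real"
  assumes \<mu>: "\<mu> \<in> borel_probs" and \<nu>: "\<nu> \<in> borel_probs"
    and c: "continuous_on UNIV (\<lambda>(w, w'). c w w')" "\<And>w w'. 0 \<le> c w w'"
  defines "E \<equiv> \<lambda>\<pi>. \<integral>\<^sup>+w'. (\<integral>\<^sup>+w. ennreal (c w w') \<partial>\<pi>) \<partial>\<pi>"
  shows "\<exists>\<pi>\<in>couplings \<mu> \<nu>. E \<pi> = (INF \<rho>\<in>couplings \<mu> \<nu>. E \<rho>)"
proof -
  have E_eq: "E \<pi> = (\<integral>\<^sup>+z. ennreal ((\<lambda>(w, w'). c w w') z) \<partial>(\<pi> \<Otimes>\<^sub>M \<pi>))" if "\<pi> \<in> couplings \<mu> \<nu>" for \<pi>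
  proof -
    have \<pi>: "\<pi> \<in> borel_probs" using couplings_borel_probs[OF \<mu> that] .
    interpret sigma_finite_measure \<pi> by (rule borel_probsD[OF \<pi>])
    interpret pair_sigma_finite \<pi> \<pi> ..
    have "(\<lambda>z. ennreal ((\<lambda>(w, w'). c w w') z)) \<in> borel_measurable (\<pi> \<Otimes>\<^sub>M \<pi>)"
      using borel_measurable_continuous_onI[OF c(1)] measurable_borel_probs[OF pair_borel_probs[OF \<pi> \<pi>]]
      by (intro measurable_compose[OF _ measurable_ennreal]) blast
    from nn_integral_snd[OF this] show ?thesis by (simp add: E_def)
  qed
  have "E ` couplings \<mu> \<nu> \<noteq> {}" using pair_in_couplings[OF \<mu> \<nu>] by auto
  from ennreal_Inf_countable_INF[OF this] obtain f :: "nat \<Rightarrow> ennreal" where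
    f: "decseq f" "range f \<subseteq> E ` couplings \<mu> \<nu>" "Inf (E ` couplings \<mu> \<nu>) = (INF i. f i)" by blast
  have "\<exists>\<pi>. \<pi> \<in> couplings \<mu> \<nu> \<and> f n = E \<pi>" for n using f(2) by blast
  then obtain M where M: "\<And>n. M n \<in> couplings \<mu> \<nu>" "\<And>n. f n = E (M n)" by metis
  obtain s \<pi> where s: "strict_mono s" and \<pi>: "\<pi> \<in> couplings \<mu> \<nu>" and
    le: "\<forall>f. continuous_on UNIV f \<longrightarrow> (\<forall>x. 0 \<le> f x) \<longrightarrow>
      (\<integral>\<^sup>+x. ennreal (f x) \<partial>(\<pi> \<Otimes>\<^sub>M \<pi>)) \<le> liminf (\<lambda>n. \<integral>\<^sup>+x. ennreal (f x) \<partial>(M (s n) \<Otimes>\<^sub>M M (s n)))"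
    by (rule couplings_limit[of \<mu> \<nu> M, OF \<mu> \<nu> M(1)]) (assumption | rule that)+
  \<comment> \<open>The chosen energies decrease to the infimum, so they have the same limit along
    the subsequence.\<close>
  have "f \<longlonglongrightarrow> (INF i. f i)" using f(1) by (rule LIMSEQ_INF)
  from LIMSEQ_subseq_LIMSEQ[OF this s] have "liminf (\<lambda>n. E (M (s n))) = (INF i. f i)"
    by (intro lim_imp_Liminf) (simp_all add: o_def M(2))
  moreover have "E \<pi> \<le> liminf (\<lambda>n. E (M (s n)))"
    unfolding E_eq[OF \<pi>] E_eq[OF M(1)] using c by (intro le[rule_format]) auto
  ultimately have "E \<pi> \<le> (INF \<rho>\<in>couplings \<mu> \<nu>. E \<rho>)" using f(3) by simp
  then show ?thesis using \<pi> by (intro bexI[of _ \<pi>] antisym INF_lower)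
qed

section \<open>Energies\<close>

lemma structured_objects_borel_probs: "\<mu> \<in> structured_objects r \<Longrightarrow> \<mu> \<in> borel_probs"
  by (simp add: structured_objects_def structured_object_def borel_probs_def)

lemma fst_borel_measurable: "fst \<in> borel_measurable borel"
  and snd_borel_measurable: "snd \<in> borel_measurable borel"
  by (simp_all add: borel_measurable_continuous_onI continuous_on_fst continuous_on_snd continuous_on_id)

lemma fgw_cost_eq:
  "fgw_cost p q \<alpha> w w' = ((1 - \<alpha>) * dist (snd (fst w)) (snd (snd w)) powr q +
     \<alpha> * \<bar>dist (fst (fst w)) (fst (fst w')) - dist (fst (snd w)) (fst (snd w'))\<bar> powr q) powr p"
  by (simp add: fgw_cost_def split: prod.split)

lemma fgw_cost_nonneg: "0 \<le> fgw_cost p q \<alpha> w w'"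
  by (simp add: fgw_cost_eq)

text \<open>The powers are continuous at base 0 as well, because the bases are nonnegative and the
  exponents positive.\<close>

lemma continuous_on_fgw_cost:
  assumes "p \<ge> 1" "q \<ge> 1" "0 < \<alpha>" "\<alpha> < 1"
  shows "continuous_on UNIV (\<lambda>(w, w'). fgw_cost p q \<alpha> w w')"
  unfolding fgw_cost_eq case_prod_beta
  using assms by (intro continuous_on_powr' continuous_intros ballI) (auto intro!: add_nonneg_nonneg)

text \<open>Serves to express the energies of different images of one measure as integrals over the
  same space \<open>\<gamma> \<Otimes>\<^sub>M \<gamma>\<close>, where the integrands can be
  compared pointwise.\<close>

lemma nn_integral_pair_distr:
  fixes h :: "'b::second_countable_topology \<times> 'b \<Rightarrow> ennreal"
  assumes \<gamma>: "\<gamma> \<in> borel_probs" and g: "g \<in> borel_measurable \<gamma>" and h: "h \<in> borel_measurable borel"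
  shows "(\<integral>\<^sup>+w'. (\<integral>\<^sup>+w. h (w, w') \<partial>distr \<gamma> borel g) \<partial>distr \<gamma> borel g) =
    (\<integral>\<^sup>+z. h (g (fst z), g (snd z)) \<partial>(\<gamma> \<Otimes>\<^sub>M \<gamma>))"
proof -
  interpret G: prob_space \<gamma> by (rule borel_probsD[OF \<gamma>])
  let ?D = "distr \<gamma> borel g"
  have D: "?D \<in> borel_probs" using G.prob_space_distr[OF g] by (simp add: borel_probs_def)
  interpret D: prob_space ?D by (rule borel_probsD[OF D])
  interpret DD: pair_sigma_finite ?D ?D ..
  have "h \<in> borel_measurable (?D \<Otimes>\<^sub>M ?D)"
    using h by (simp add: measurable_borel_probs[OF pair_borel_probs[OF D D]])
  then have "(\<integral>\<^sup>+w'. (\<integral>\<^sup>+w. h (w, w') \<partial>?D) \<partial>?D) = (\<integral>\<^sup>+z. h z \<partial>(?D \<Otimes>\<^sub>M ?D))"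
    by (rule DD.nn_integral_snd)
  also have "?D \<Otimes>\<^sub>M ?D = distr (\<gamma> \<Otimes>\<^sub>M \<gamma>) (borel \<Otimes>\<^sub>M borel) (\<lambda>(x, y). (g x, g y))"
    by (intro pair_measure_distr g D.sigma_finite_measure_axioms)
  also have "\<dots> = distr (\<gamma> \<Otimes>\<^sub>M \<gamma>) borel (\<lambda>(x, y). (g x, g y))" by (simp add: borel_prod)
  also have "(\<integral>\<^sup>+z. h z \<partial>\<dots>) = (\<integral>\<^sup>+z. h (g (fst z), g (snd z)) \<partial>(\<gamma> \<Otimes>\<^sub>M \<gamma>))"
    using g h by (subst nn_integral_distr) (auto simp: case_prod_beta intro!: borel_measurable_Pair)
  finally show ?thesis .
qed

lemma nn_integral_pair_fst:
  fixes h :: "'b::topological_space \<Rightarrow> ennreal"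
  assumes \<gamma>: "\<gamma> \<in> borel_probs" and g: "g \<in> borel_measurable \<gamma>" and h: "h \<in> borel_measurable borel"
  shows "(\<integral>\<^sup>+z. h (g (fst z)) \<partial>(\<gamma> \<Otimes>\<^sub>M \<gamma>)) = (\<integral>\<^sup>+x. h x \<partial>distr \<gamma> borel g)"
proof -
  interpret prob_space \<gamma> by (rule borel_probsD[OF \<gamma>])
  have [measurable]: "(\<lambda>x. h (g x)) \<in> borel_measurable \<gamma>" using measurable_compose[OF g h] .
  have "(\<integral>\<^sup>+z. h (g (fst z)) \<partial>(\<gamma> \<Otimes>\<^sub>M \<gamma>)) = (\<integral>\<^sup>+x. \<integral>\<^sup>+y. h (g (fst (x, y))) \<partial>\<gamma> \<partial>\<gamma>)"
    by (rule nn_integral_fst[symmetric]) measurable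
  then show ?thesis using g h by (simp add: emeasure_space_1 nn_integral_distr)
qed

lemma fgw_energy_distr:
  assumes p: "p \<ge> 1" "q \<ge> 1" "0 < \<alpha>" "\<alpha> < 1" and \<gamma>: "\<gamma> \<in> borel_probs" and g: "g \<in> borel_measurable \<gamma>"
  shows "fgw_energy p q \<alpha> (distr \<gamma> borel g) = (\<integral>\<^sup>+z. ennreal (fgw_cost p q \<alpha> (g (fst z)) (g (snd z))) \<partial>(\<gamma> \<Otimes>\<^sub>M \<gamma>))"
proof -
  have "(\<lambda>z. ennreal ((\<lambda>(w, w'). fgw_cost p q \<alpha> w w') z)) \<in> borel_measurable borel"
    by (intro measurable_compose[OF _ measurable_ennreal] borel_measurable_continuous_onI continuous_on_fgw_cost p)
  from nn_integral_pair_distr[OF \<gamma> g this] show ?thesis by (simp add: fgw_energy_def)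
qed

lemma fgw_energy_eq:
  assumes "p \<ge> 1" "q \<ge> 1" "0 < \<alpha>" "\<alpha> < 1" and \<pi>: "\<pi> \<in> borel_probs"
  shows "fgw_energy p q \<alpha> \<pi> = (\<integral>\<^sup>+z. ennreal (fgw_cost p q \<alpha> (fst z) (snd z)) \<partial>(\<pi> \<Otimes>\<^sub>M \<pi>))"
proof -
  have "distr \<pi> borel (\<lambda>x. x) = \<pi>" using borel_probsD[OF \<pi>] by (intro distr_id2) simp
  then show ?thesis
    using fgw_energy_distr[OF assms, of "\<lambda>x. x"] by (simp add: measurable_borel_probs[OF \<pi>])
qed

text \<open>Exchanging the two points of a coupling preserves the cost, since distances are
  symmetric and the structural difference enters by its absolute value. Symmetry of
  \<open>FGW\<close> follows by using the inequality in both directions.\<close>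

lemma INF_fgw_energy_swap_le:
  fixes \<mu> :: "('x::polish_space \<times> 'o::polish_space) measure" and \<nu> :: "('y::polish_space \<times> 'o) measure"
  assumes p: "p \<ge> 1" "q \<ge> 1" "0 < \<alpha>" "\<alpha> < 1" and \<mu>: "\<mu> \<in> borel_probs"
  shows "(INF \<pi>\<in>couplings \<nu> \<mu>. fgw_energy p q \<alpha> \<pi>) \<le> (INF \<pi>\<in>couplings \<mu> \<nu>. fgw_energy p q \<alpha> \<pi>)"
proof (rule INF_greatest)
  fix \<pi> assume c: "\<pi> \<in> couplings \<mu> \<nu>"
  have \<pi>: "\<pi> \<in> borel_probs" by (rule couplings_borel_probs[OF \<mu> c])
  let ?g = "\<lambda>w :: ('x \<times> 'o) \<times> 'y \<times> 'o. (snd w, fst w)"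
  have g: "?g \<in> borel_measurable \<pi>"
    by (intro borel_measurable_Pair measurable_fst_borel measurable_snd_borel \<pi>)
  have "distr \<pi> borel ?g \<in> couplings \<nu> \<mu>"
    using couplingsD[OF c] distr_distr[OF fst_borel_measurable g] distr_distr[OF snd_borel_measurable g]
    by (simp add: couplings_def o_def)
  moreover have "fgw_energy p q \<alpha> (distr \<pi> borel ?g) = fgw_energy p q \<alpha> \<pi>"
    unfolding fgw_energy_distr[OF p \<pi> g] fgw_energy_eq[OF p \<pi>]
    by (simp add: fgw_cost_eq dist_commute abs_minus_commute)
  ultimately show "(INF \<pi>\<in>couplings \<nu> \<mu>. fgw_energy p q \<alpha> \<pi>) \<le> fgw_energy p q \<alpha> \<pi>"
    by (auto intro: INF_lower2)
qed

section \<open>Minkowski inequalities\<close>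

text \<open>Convexity of the power, applied to
  \<open>u + v = (F + G) * (s * (u / F) + (1 - s) * (v / G))\<close> with
  \<open>s = F / (F + G)\<close>. With norms for \<open>F\<close> and \<open>G\<close> it integrates
  to Minkowski's inequality; with \<open>F = G = 1\<close> it gives the factor
  \<open>2 powr (r - 1)\<close>.\<close>

lemma powr_add_le:
  fixes r u v F G :: real
  assumes r: "r \<ge> 1" and "u \<ge> 0" "v \<ge> 0" and F: "F > 0" and G: "G > 0"
  shows "(u + v) powr r \<le> (F + G) powr r * (F / (F + G) * (u powr r / F powr r) + G / (F + G) * (v powr r / G powr r))"
proof -
  define s where "s = F / (F + G)"
  have s: "0 < s" "s < 1" "1 - s = G / (F + G)" using F G by (auto simp: s_def field_simps)
  have pw: "t powr r \<le> t" if "0 < t" "t < 1" for t :: real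
    using powr_mono'[of 1 r t] that r by simp
  have "(s * (u / F) + (1 - s) * (v / G)) powr r \<le> s * (u / F) powr r + (1 - s) * (v / G) powr r"
  proof (cases "u = 0 \<or> v = 0")
    case True
    \<comment> \<open>With a zero argument the sum has one term left, and
      \<open>t powr r \<le> t\<close> on the unit interval replaces convexity.\<close>
    have "(t * w) powr r \<le> t * w powr r" if "0 < t" "t < 1" "w \<ge> 0" for t w :: real
      using pw[OF that(1,2)] that by (simp add: powr_mult mult_right_mono)
    from this[of s "u / F"] this[of "1 - s" "v / G"] True show ?thesis
      using s assms by auto
  next
    case False
    then show ?thesis
      using convex_onD[OF powr_convex[OF r], of "1 - s" "u / F" "v / G"] s(1,2) assms by simp
  qed
  moreover have "u + v = (F + G) * (s * (u / F) + (1 - s) * (v / G))"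
  proof -
    have "(F + G) * s = F" "(F + G) * (1 - s) = G" using F G by (simp_all add: s_def field_simps)
    then have "(F + G) * (s * (u / F) + (1 - s) * (v / G)) = F * (u / F) + G * (v / G)"
      by (simp only: distrib_left mult.assoc[symmetric])
    then show ?thesis using F G by simp
  qed
  then have "(u + v) powr r = (F + G) powr r * (s * (u / F) + (1 - s) * (v / G)) powr r"
    using s assms by (simp add: powr_mult)
  ultimately show ?thesis
    using F G assms by (simp add: s(3) powr_divide flip: s_def)
qed

text \<open>\<open>F\<close> and \<open>G\<close> bound the \<open>r\<close>-norms; weighting the
  pointwise inequality by them makes the integrated bound collapse to \<open>(F + G) powr r\<close>.
  Both are divided by, so a vanishing norm is treated through a slightly larger bound.\<close>

lemma nn_integral_Minkowski:
  fixes f g :: "'a \<Rightarrow> real"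
  assumes r: "r \<ge> 1" and [measurable]: "f \<in> borel_measurable M" "g \<in> borel_measurable M"
    and nn: "\<And>x. 0 \<le> f x" "\<And>x. 0 \<le> g x" and F: "F > 0" and G: "G > 0"
    and le: "(\<integral>\<^sup>+x. ennreal (f x powr r) \<partial>M) \<le> ennreal (F powr r)"
      "(\<integral>\<^sup>+x. ennreal (g x powr r) \<partial>M) \<le> ennreal (G powr r)"
  shows "(\<integral>\<^sup>+x. ennreal ((f x + g x) powr r) \<partial>M) \<le> ennreal ((F + G) powr r)"
proof -
  define a where "a = (F + G) powr r * (F / (F + G) / F powr r)"
  define b where "b = (F + G) powr r * (G / (F + G) / G powr r)"
  have ab: "a \<ge> 0" "b \<ge> 0" using F G by (auto simp: a_def b_def)
  have "(\<integral>\<^sup>+x. ennreal ((f x + g x) powr r) \<partial>M) \<le> (\<integral>\<^sup>+x. ennreal a * ennreal (f x powr r) + ennreal b * ennreal (g x powr r) \<partial>M)"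
  proof (rule nn_integral_mono)
    fix x
    have "(f x + g x) powr r \<le> a * f x powr r + b * g x powr r"
      using powr_add_le[OF r nn(1)[of x] nn(2)[of x] F G] by (simp add: a_def b_def algebra_simps)
    then show "ennreal ((f x + g x) powr r) \<le> ennreal a * ennreal (f x powr r) + ennreal b * ennreal (g x powr r)"
      using ab by (simp add: ennreal_leI flip: ennreal_mult ennreal_plus)
  qed
  also have "\<dots> = ennreal a * (\<integral>\<^sup>+x. ennreal (f x powr r) \<partial>M) + ennreal b * (\<integral>\<^sup>+x. ennreal (g x powr r) \<partial>M)"
    by (simp add: nn_integral_add nn_integral_cmult)
  also have "\<dots> \<le> ennreal a * ennreal (F powr r) + ennreal b * ennreal (G powr r)"
    by (intro add_mono mult_left_mono le) auto
  also have "\<dots> = ennreal (a * F powr r + b * G powr r)"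
    using ab by (simp flip: ennreal_mult ennreal_plus)
  also have "a * F powr r + b * G powr r = (F + G) powr r"
    using F G by (simp add: a_def b_def flip: add_divide_distrib distrib_left)
  finally show ?thesis .
qed

definition weighted_norm :: "real \<Rightarrow> real \<Rightarrow> real \<Rightarrow> real \<Rightarrow> real" where
  "weighted_norm q \<alpha> u v = ((1 - \<alpha>) * u powr q + \<alpha> * v powr q) powr (1 / q)"

lemma weighted_norm_nonneg: "0 \<le> weighted_norm q \<alpha> u v"
  by (simp add: weighted_norm_def)

lemma weighted_norm_powr:
  assumes "q \<ge> 1" "0 < \<alpha>" "\<alpha> < 1"
  shows "weighted_norm q \<alpha> u v powr q = (1 - \<alpha>) * u powr q + \<alpha> * v powr q"
  using assms by (simp add: weighted_norm_def powr_powr)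

lemma weighted_norm_le_iff:
  assumes q: "q \<ge> 1" "0 < \<alpha>" "\<alpha> < 1" and "0 \<le> c"
  shows "weighted_norm q \<alpha> u v \<le> c \<longleftrightarrow> (1 - \<alpha>) * u powr q + \<alpha> * v powr q \<le> c powr q"
  unfolding weighted_norm_powr[OF q, symmetric]
  using assms weighted_norm_nonneg[of q \<alpha> u v] by (metis less_eq_real_def not_le powr_less_mono2 powr_mono2 order_less_le_trans zero_less_one)

lemma weighted_norm_mono:
  assumes q: "q \<ge> 1" "0 < \<alpha>" "\<alpha> < 1" and "0 \<le> u" "u \<le> u'" "0 \<le> v" "v \<le> v'"
  shows "weighted_norm q \<alpha> u v \<le> weighted_norm q \<alpha> u' v'"
  unfolding weighted_norm_def using assms
  by (intro powr_mono2 add_mono mult_left_mono) auto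

text \<open>Minkowski's inequality on two points of mass \<open>1 - \<alpha>\<close> and
  \<open>\<alpha>\<close>, from the same convexity bound with the norms themselves as
  \<open>F\<close> and \<open>G\<close>. A vanishing norm forces its vector to be zero.\<close>

lemma weighted_norm_add:
  assumes q: "q \<ge> 1" "0 < \<alpha>" "\<alpha> < 1" and nn: "0 \<le> u" "0 \<le> u'" "0 \<le> v" "0 \<le> v'"
  shows "weighted_norm q \<alpha> (u + u') (v + v') \<le> weighted_norm q \<alpha> u v + weighted_norm q \<alpha> u' v'"
proof -
  let ?F = "weighted_norm q \<alpha> u v" and ?G = "weighted_norm q \<alpha> u' v'"
  have z: "a = 0 \<and> b = 0" if "weighted_norm q \<alpha> a b = 0" "0 \<le> a" "0 \<le> b" for a b
  proof -
    have "(1 - \<alpha>) * a powr q + \<alpha> * b powr q = 0"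
      using that(1) weighted_norm_powr[OF q, of a b] q by simp
    then show ?thesis using q that
      by (simp add: add_nonneg_eq_0_iff)
  qed
  \<comment> \<open>Regroups a sum over the two coordinates into a sum over the two vectors.\<close>
  have id: "(1 - a) * (H * (A * (x / f) + B * (y / g))) + a * (H * (A * (x' / f) + B * (y' / g)))
    = H * (A * (((1 - a) * x + a * x') / f) + B * (((1 - a) * y + a * y') / g))"
    for a A B H x y x' y' f g :: real
    by (simp add: add_divide_distrib diff_divide_distrib algebra_simps)
  consider "?F = 0" | "?G = 0" | "?F > 0" "?G > 0"
    using weighted_norm_nonneg[of q \<alpha>] by (metis less_eq_real_def)
  then show ?thesis
  proof cases
    case 3
    let ?A = "?F / (?F + ?G)" and ?B = "?G / (?F + ?G)"
    have "(1 - \<alpha>) * (u + u') powr q + \<alpha> * (v + v') powr q \<le>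
      (1 - \<alpha>) * ((?F + ?G) powr q * (?A * (u powr q / ?F powr q) + ?B * (u' powr q / ?G powr q))) +
      \<alpha> * ((?F + ?G) powr q * (?A * (v powr q / ?F powr q) + ?B * (v' powr q / ?G powr q)))"
      using q nn 3 by (intro add_mono mult_left_mono powr_add_le) auto
    also have "\<dots> = (?F + ?G) powr q * (?A * (((1 - \<alpha>) * u powr q + \<alpha> * v powr q) / ?F powr q)
      + ?B * (((1 - \<alpha>) * u' powr q + \<alpha> * v' powr q) / ?G powr q))"
      by (rule id)
    also have "\<dots> = (?F + ?G) powr q * (?A + ?B)"
      unfolding weighted_norm_powr[OF q, symmetric] using 3 by simp
    also have "?A + ?B = 1" using 3 by (simp flip: add_divide_distrib)
    finally show ?thesis using 3 by (subst weighted_norm_le_iff[OF q]) auto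
  next
    case 1
    from z[OF this nn(1,3)] 1 show ?thesis by simp
  next
    case 2
    from z[OF this nn(2,4)] 2 show ?thesis by simp
  qed
qed

text \<open>The weights sum to 1; hence errors of the same size in feature and structure together
  cost exactly that size.\<close>

lemma weighted_norm_diag:
  assumes "q \<ge> 1" "0 \<le> d"
  shows "weighted_norm q \<alpha> d d = d"
proof -
  have "(1 - \<alpha>) * d powr q + \<alpha> * d powr q = d powr q" by (simp add: algebra_simps)
  then show ?thesis using assms by (simp add: weighted_norm_def powr_powr)
qed

lemma fgw_cost_weighted_norm:
  assumes q: "q \<ge> 1" "0 < \<alpha>" "\<alpha> < 1"
  shows "fgw_cost p q \<alpha> w w' = weighted_norm q \<alpha> (dist (snd (fst w)) (snd (snd w)))
     \<bar>dist (fst (fst w)) (fst (fst w')) - dist (fst (snd w)) (fst (snd w'))\<bar> powr (p * q)"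
  unfolding fgw_cost_eq weighted_norm_powr[OF q, symmetric] by (simp add: powr_powr mult.commute)

text \<open>The sum is at most five times the largest term, and the power of that term is one of the
  summands. Five is the number of distances that bound the cost in the finiteness proof.\<close>

lemma powr_sum5_le:
  fixes a b c d e r :: real
  assumes nn: "0 \<le> a" "0 \<le> b" "0 \<le> c" "0 \<le> d" "0 \<le> e" and r: "r \<ge> 1"
  shows "(a + b + c + d + e) powr r \<le> 5 powr r * (a powr r + b powr r + c powr r + d powr r + e powr r)"
proof -
  define m where "m = Max {a, b, c, d, e}"
  have le: "a \<le> m" "b \<le> m" "c \<le> m" "d \<le> m" "e \<le> m" by (simp_all add: m_def)
  have "m \<in> {a, b, c, d, e}" unfolding m_def by (rule Max_in) auto
  then have "m powr r \<le> a powr r + b powr r + c powr r + d powr r + e powr r"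
    using powr_ge_zero[of a r] powr_ge_zero[of b r] powr_ge_zero[of c r] powr_ge_zero[of d r] powr_ge_zero[of e r]
    by (elim insertE emptyE) simp_all
  moreover have "(a + b + c + d + e) powr r \<le> (5 * m) powr r"
    using nn r le by (intro powr_mono2) linarith+
  moreover have "(5 * m) powr r = 5 powr r * m powr r"
    by (rule powr_mult)
  ultimately show ?thesis by (smt (verit) mult_left_mono powr_ge_zero)
qed

text \<open>Feature and structure discrepancies are both at most a sum of five distances: two to
  base points, the one between the base points, and the two structural ones. The power
  \<open>p * q\<close> of each nonconstant one has an integral fixed by a single marginal, so the
  bound holds for every coupling.\<close>

lemma fgw_energy_finite:
  fixes \<mu> :: "('x::polish_space \<times> 'o::polish_space) measure" and \<nu> :: "('y::polish_space \<times> 'o) measure"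
  assumes p: "p \<ge> 1" "q \<ge> 1" "0 < \<alpha>" "\<alpha> < 1"
    and \<mu>: "\<mu> \<in> structured_objects (p * q)" and \<nu>: "\<nu> \<in> structured_objects (p * q)"
    and c: "\<pi> \<in> couplings \<mu> \<nu>"
  shows "fgw_energy p q \<alpha> \<pi> < \<infinity>"
proof -
  have \<pi>: "\<pi> \<in> borel_probs" using couplings_borel_probs[OF structured_objects_borel_probs[OF \<mu>] c] .
  interpret prob_space \<pi> by (rule borel_probsD[OF \<pi>])
  note c = couplingsD[OF c]
  let ?r = "p * q"
  obtain a0 b0 where
    a0: "(\<integral>\<^sup>+a. ennreal (dist a a0 powr ?r) \<partial>marg_feat \<mu>) < \<infinity>" and
    b0: "(\<integral>\<^sup>+a. ennreal (dist a b0 powr ?r) \<partial>marg_feat \<nu>) < \<infinity>" and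
    xx: "(\<integral>\<^sup>+x'. (\<integral>\<^sup>+x. ennreal (dist x x' powr ?r) \<partial>marg_struct \<mu>) \<partial>marg_struct \<mu>) < \<infinity>" and
    yy: "(\<integral>\<^sup>+x'. (\<integral>\<^sup>+x. ennreal (dist x x' powr ?r) \<partial>marg_struct \<nu>) \<partial>marg_struct \<nu>) < \<infinity>"
    using \<mu> \<nu> unfolding structured_objects_def by blast
  have r: "?r \<ge> 1" using p mult_mono'[of 1 p 1 q] by simp
  let ?P = "\<pi> \<Otimes>\<^sub>M \<pi>"
  have comp: "(\<lambda>w. fst (fst w)) \<in> borel_measurable \<pi>" "(\<lambda>w. snd (fst w)) \<in> borel_measurable \<pi>"
    "(\<lambda>w. fst (snd w)) \<in> borel_measurable \<pi>" "(\<lambda>w. snd (snd w)) \<in> borel_measurable \<pi>"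
    using measurable_fst_borel[OF \<pi>] measurable_snd_borel[OF \<pi>] fst_borel_measurable snd_borel_measurable
    by (blast intro: measurable_compose)+
  have d1: "(\<lambda>a. ennreal (dist a b powr ?r)) \<in> borel_measurable borel" for b :: "'b::{metric_space,second_countable_topology}"
    by measurable
  have d2: "(\<lambda>z. ennreal (dist (fst z) (snd z) powr ?r)) \<in> borel_measurable (borel :: ('b \<times> 'b::{metric_space,second_countable_topology}) measure)"
    by (simp add: borel_prod[symmetric])
  have A: "(\<integral>\<^sup>+z. ennreal (dist (snd (fst (fst z))) a0 powr ?r) \<partial>?P) < \<infinity>"
    using a0 nn_integral_pair_fst[OF \<pi> comp(2) d1, of a0] distr_distr[OF snd_borel_measurable measurable_fst_borel[OF \<pi>]]
    by (simp add: marg_feat_def c(2)[symmetric] o_def)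
  have B: "(\<integral>\<^sup>+z. ennreal (dist (snd (snd (fst z))) b0 powr ?r) \<partial>?P) < \<infinity>"
    using b0 nn_integral_pair_fst[OF \<pi> comp(4) d1, of b0] distr_distr[OF snd_borel_measurable measurable_snd_borel[OF \<pi>]]
    by (simp add: marg_feat_def c(3)[symmetric] o_def)
  have X: "(\<integral>\<^sup>+z. ennreal (dist (fst (fst (fst z))) (fst (fst (snd z))) powr ?r) \<partial>?P) < \<infinity>"
    using xx nn_integral_pair_distr[OF \<pi> comp(1) d2] distr_distr[OF fst_borel_measurable measurable_fst_borel[OF \<pi>]]
    by (simp add: marg_struct_def c(2)[symmetric] o_def)
  have Y: "(\<integral>\<^sup>+z. ennreal (dist (fst (snd (fst z))) (fst (snd (snd z))) powr ?r) \<partial>?P) < \<infinity>"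
    using yy nn_integral_pair_distr[OF \<pi> comp(3) d2] distr_distr[OF fst_borel_measurable measurable_snd_borel[OF \<pi>]]
    by (simp add: marg_struct_def c(3)[symmetric] o_def)
  have meas: "(\<lambda>z. ennreal (dist (snd (fst (fst z))) a0 powr ?r)) \<in> borel_measurable ?P"
    "(\<lambda>z. ennreal (dist (snd (snd (fst z))) b0 powr ?r)) \<in> borel_measurable ?P"
    "(\<lambda>z. ennreal (dist (fst (fst (fst z))) (fst (fst (snd z))) powr ?r)) \<in> borel_measurable ?P"
    "(\<lambda>z. ennreal (dist (fst (snd (fst z))) (fst (snd (snd z))) powr ?r)) \<in> borel_measurable ?P"
    using comp by measurable
  let ?C = "ennreal (5 powr ?r)" and ?d = "ennreal (dist a0 b0 powr ?r)"
  have "fgw_energy p q \<alpha> \<pi> \<le> (\<integral>\<^sup>+z. ?C * (ennreal (dist (snd (fst (fst z))) a0 powr ?r)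
     + ennreal (dist (snd (snd (fst z))) b0 powr ?r) + ?d
     + ennreal (dist (fst (fst (fst z))) (fst (fst (snd z))) powr ?r)
     + ennreal (dist (fst (snd (fst z))) (fst (snd (snd z))) powr ?r)) \<partial>?P)"
    unfolding fgw_energy_eq[OF p \<pi>]
  proof (rule nn_integral_mono)
    fix z :: "(('x \<times> 'o) \<times> 'y \<times> 'o) \<times> ('x \<times> 'o) \<times> 'y \<times> 'o"
    let ?a = "dist (snd (fst (fst z))) a0" and ?b = "dist (snd (snd (fst z))) b0"
    let ?x = "dist (fst (fst (fst z))) (fst (fst (snd z)))" and ?y = "dist (fst (snd (fst z))) (fst (snd (snd z)))"
    let ?s = "?a + ?b + dist a0 b0 + ?x + ?y"
    have "dist (snd (fst (fst z))) (snd (snd (fst z))) \<le> ?a + ?b + dist a0 b0"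
      using dist_triangle[of "snd (fst (fst z))" "snd (snd (fst z))" a0] dist_triangle[of a0 "snd (snd (fst z))" b0]
      by (simp add: dist_commute)
    then have "dist (snd (fst (fst z))) (snd (snd (fst z))) \<le> ?s" "\<bar>?x - ?y\<bar> \<le> ?s"
      using zero_le_dist[of "snd (fst (fst z))" a0] zero_le_dist[of "snd (snd (fst z))" b0] zero_le_dist[of a0 b0]
        zero_le_dist[of "fst (fst (fst z))" "fst (fst (snd z))"] zero_le_dist[of "fst (snd (fst z))" "fst (snd (snd z))"]
      by linarith+
    \<comment> \<open>Both arguments are raised to the common bound \<open>?s\<close>, where the
      norm is \<open>?s\<close> itself.\<close>
    then have "weighted_norm q \<alpha> (dist (snd (fst (fst z))) (snd (snd (fst z)))) \<bar>?x - ?y\<bar> \<le> weighted_norm q \<alpha> ?s ?s"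
      by (intro weighted_norm_mono p) auto
    also have "\<dots> = ?s" using p by (intro weighted_norm_diag) auto
    finally have "fgw_cost p q \<alpha> (fst z) (snd z) \<le> ?s powr ?r"
      unfolding fgw_cost_weighted_norm[OF p(2-4)] using r weighted_norm_nonneg by (intro powr_mono2) auto
    also have "\<dots> \<le> 5 powr ?r * (?a powr ?r + ?b powr ?r + dist a0 b0 powr ?r + ?x powr ?r + ?y powr ?r)"
      using r by (intro powr_sum5_le) auto
    finally show "ennreal (fgw_cost p q \<alpha> (fst z) (snd z)) \<le> ?C * (ennreal (?a powr ?r)
     + ennreal (?b powr ?r) + ?d + ennreal (?x powr ?r) + ennreal (?y powr ?r))"
      by (simp add: ennreal_leI flip: ennreal_mult ennreal_plus)
  qed
  also have "\<dots> = ?C * ((\<integral>\<^sup>+z. ennreal (dist (snd (fst (fst z))) a0 powr ?r) \<partial>?P)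
     + (\<integral>\<^sup>+z. ennreal (dist (snd (snd (fst z))) b0 powr ?r) \<partial>?P) + ?d
     + (\<integral>\<^sup>+z. ennreal (dist (fst (fst (fst z))) (fst (fst (snd z))) powr ?r) \<partial>?P)
     + (\<integral>\<^sup>+z. ennreal (dist (fst (snd (fst z))) (fst (snd (snd z))) powr ?r) \<partial>?P))"
    using meas prob_space.emeasure_space_1[OF borel_probsD(1)[OF pair_borel_probs[OF \<pi> \<pi>]]]
    by (simp add: nn_integral_cmult nn_integral_add)
  also have "\<dots> < \<infinity>"
    using A B X Y by (simp add: ennreal_mult_less_top)
  finally show ?thesis .
qed

section \<open>The triangle inequality\<close>

text \<open>\<open>k z\<close> is the index of the first point of a dense sequence within
  \<open>\<delta> / 2\<close> of \<open>z\<close>; two points with the same index are close to one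
  common point.\<close>

lemma countable_partition_small:
  fixes \<delta> :: real
  assumes "\<delta> > 0"
  obtains k :: "'z::{metric_space,second_countable_topology} \<Rightarrow> nat"
  where "k \<in> measurable borel (count_space UNIV)" "\<And>z z'. k z = k z' \<Longrightarrow> dist z z' \<le> \<delta>"
proof -
  obtain D :: "'z set" where D: "countable D" "\<And>X. open X \<Longrightarrow> X \<noteq> {} \<Longrightarrow> \<exists>d\<in>D. d \<in> X"
    using countable_dense_setE by metis
  define d where "d = from_nat_into D"
  have "D \<noteq> {}" using D(2)[of UNIV] by auto
  then have rd: "range d = D" unfolding d_def by (intro range_from_nat_into D)
  have ex: "\<exists>n. dist z (d n) < \<delta> / 2" for z
  proof -
    obtain y where "y \<in> D" "y \<in> ball z (\<delta> / 2)" using D(2)[of "ball z (\<delta> / 2)"] assms by auto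
    then show ?thesis using rd by (auto simp: image_iff)
  qed
  define k where "k z = (LEAST n. dist z (d n) < \<delta> / 2)" for z
  show ?thesis
  proof
    show "k \<in> measurable borel (count_space UNIV)" unfolding k_def by measurable
    fix z z' assume "k z = k z'"
    moreover have "dist x (d (k x)) < \<delta> / 2" for x unfolding k_def using ex by (rule LeastI_ex)
    ultimately have "dist z (d (k z)) < \<delta> / 2" "dist z' (d (k z)) < \<delta> / 2" by metis+
    then show "dist z z' \<le> \<delta>" using dist_triangle2[of z z' "d (k z)"] by simp
  qed
qed

text \<open>By Tonelli, the section integrals of \<open>h\<close> are the densities of the two
  marginals with respect to \<open>M\<close> and \<open>N\<close>.\<close>

lemma density_pair_in_couplings:
  fixes M :: "'a::second_countable_topology measure" and N :: "'b::second_countable_topology measure"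
  assumes M: "M \<in> borel_probs" and N: "N \<in> borel_probs"
    and h[measurable]: "h \<in> borel_measurable (M \<Otimes>\<^sub>M N)"
    and 1: "AE x in M. (\<integral>\<^sup>+y. h (x, y) \<partial>N) = 1" and 2: "AE y in N. (\<integral>\<^sup>+x. h (x, y) \<partial>M) = 1"
  shows "density (M \<Otimes>\<^sub>M N) h \<in> couplings M N"
proof -
  interpret M: prob_space M by (rule borel_probsD[OF M])
  interpret N: prob_space N by (rule borel_probsD[OF N])
  interpret pair_sigma_finite M N ..
  let ?D = "density (M \<Otimes>\<^sub>M N) h"
  have s: "sets ?D = sets borel" using borel_probsD(4)[OF pair_borel_probs[OF M N]] by simp
  have sp: "space ?D = UNIV" using borel_probsD(5)[OF pair_borel_probs[OF M N]] by simp
  have fm: "fst \<in> measurable ?D borel" "snd \<in> measurable ?D borel"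
    using fst_borel_measurable snd_borel_measurable by (simp_all only: measurable_cong_sets[OF s refl])
  have "distr ?D borel fst = M"
  proof (rule measure_eqI)
    show "sets (distr ?D borel fst) = sets M" by (simp add: borel_probsD[OF M])
    fix A assume "A \<in> sets (distr ?D borel fst)"
    then have A[measurable]: "A \<in> sets M" by (simp add: borel_probsD[OF M])
    have "emeasure (distr ?D borel fst) A = emeasure ?D (fst -` A \<inter> space ?D)"
      using A fm by (intro emeasure_distr) (simp_all add: borel_probsD[OF M])
    also have "\<dots> = (\<integral>\<^sup>+z. h z * indicator (fst -` A \<inter> space ?D) z \<partial>(M \<Otimes>\<^sub>M N))"
      using measurable_sets[OF fm(1), of A] A by (intro emeasure_density h) (simp add: borel_probsD[OF M])
    also have "\<dots> = (\<integral>\<^sup>+z. h z * indicator A (fst z) \<partial>(M \<Otimes>\<^sub>M N))"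
      by (intro nn_integral_cong) (auto simp: sp split: split_indicator)
    also have "\<dots> = (\<integral>\<^sup>+x. (\<integral>\<^sup>+y. h (x, y) * indicator A (fst (x, y)) \<partial>N) \<partial>M)"
      by (rule N.nn_integral_fst[symmetric]) measurable
    also have "\<dots> = (\<integral>\<^sup>+x. (\<integral>\<^sup>+y. h (x, y) \<partial>N) * indicator A x \<partial>M)"
      by (intro nn_integral_cong) (simp add: nn_integral_multc)
    also have "\<dots> = (\<integral>\<^sup>+x. indicator A x \<partial>M)"
      using 1 by (intro nn_integral_cong_AE) auto
    finally show "emeasure (distr ?D borel fst) A = emeasure M A" by simp
  qed
  moreover have "distr ?D borel snd = N"
  proof (rule measure_eqI)
    show "sets (distr ?D borel snd) = sets N" by (simp add: borel_probsD[OF N])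
    fix A assume "A \<in> sets (distr ?D borel snd)"
    then have A[measurable]: "A \<in> sets N" by (simp add: borel_probsD[OF N])
    have "emeasure (distr ?D borel snd) A = emeasure ?D (snd -` A \<inter> space ?D)"
      using A fm by (intro emeasure_distr) (simp_all add: borel_probsD[OF N])
    also have "\<dots> = (\<integral>\<^sup>+z. h z * indicator (snd -` A \<inter> space ?D) z \<partial>(M \<Otimes>\<^sub>M N))"
      using measurable_sets[OF fm(2), of A] A by (intro emeasure_density h) (simp add: borel_probsD[OF N])
    also have "\<dots> = (\<integral>\<^sup>+z. h z * indicator A (snd z) \<partial>(M \<Otimes>\<^sub>M N))"
      by (intro nn_integral_cong) (auto simp: sp split: split_indicator)
    also have "\<dots> = (\<integral>\<^sup>+y. (\<integral>\<^sup>+x. h (x, y) * indicator A (snd (x, y)) \<partial>M) \<partial>N)"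
      by (rule nn_integral_snd[symmetric]) measurable
    also have "\<dots> = (\<integral>\<^sup>+y. (\<integral>\<^sup>+x. h (x, y) \<partial>M) * indicator A y \<partial>N)"
      by (intro nn_integral_cong) (simp add: nn_integral_multc)
    also have "\<dots> = (\<integral>\<^sup>+y. indicator A y \<partial>N)"
      using 2 by (intro nn_integral_cong_AE) auto
    finally show "emeasure (distr ?D borel snd) A = emeasure N A" by simp
  qed
  ultimately show ?thesis using s by (simp add: couplings_def)
qed

text \<open>A substitute for the gluing lemma that needs no disintegration: the two couplings are made
  conditionally independent given the cell of a fine partition that contains the middle point,
  so the two copies of the middle point agree only up to \<open>\<delta>\<close>.\<close>

lemma approximate_gluing:
  fixes \<mu> :: "'a::second_countable_topology measure" and \<nu> :: "'b::second_countable_topology measure"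
    and \<beta> :: "'z::{metric_space,second_countable_topology} measure"
  assumes \<beta>: "\<beta> \<in> borel_probs" and \<pi>1: "\<pi>1 \<in> couplings \<mu> \<beta>" "\<pi>1 \<in> borel_probs"
    and \<pi>2: "\<pi>2 \<in> couplings \<beta> \<nu>" "\<pi>2 \<in> borel_probs" and "\<delta> > 0"
  obtains \<gamma> where "\<gamma> \<in> couplings \<pi>1 \<pi>2" "AE w in \<gamma>. dist (snd (fst w)) (fst (snd w)) \<le> \<delta>"
proof -
  obtain k :: "'z \<Rightarrow> nat" where k[measurable]: "k \<in> measurable borel (count_space UNIV)"
    and small: "\<And>z z'. k z = k z' \<Longrightarrow> dist z z' \<le> \<delta>"
    using countable_partition_small[OF \<open>\<delta> > 0\<close>] by blast
  interpret B: prob_space \<beta> by (rule borel_probsD[OF \<beta>])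
  define c where "c n = emeasure \<beta> (k -` {n})" for n
  have cell: "k -` {n} \<in> sets borel" for n using measurable_sets[OF k, of "{n}"] by simp
  have [measurable]: "snd \<in> borel_measurable \<pi>1" "fst \<in> borel_measurable \<pi>2"
    using measurable_snd_borel[OF \<pi>1(2)] measurable_fst_borel[OF \<pi>2(2)] .
  \<comment> \<open>There are countably many cells, so those of mass zero are negligible together;
    on the others the inverse of \<open>c\<close> is finite.\<close>
  have dens: "AE z in \<beta>. c (k z) \<noteq> 0"
  proof -
    have "AE z in \<beta>. c (k z) = 0 \<longrightarrow> k z \<noteq> n" for n
    proof (cases "c n = 0")
      case True
      then show ?thesis
        using cell by (intro AE_I[where N="k -` {n}"]) (auto simp: c_def borel_probsD[OF \<beta>])
    qed auto
    then have "AE z in \<beta>. \<forall>n. c (k z) = 0 \<longrightarrow> k z \<noteq> n" unfolding AE_all_countable by blast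
    then show ?thesis by eventually_elim auto
  qed
  have fib: "(\<integral>\<^sup>+z. indicator (k -` {n}) z * inverse (c n) \<partial>\<beta>) = 1" if "c n \<noteq> 0" for n
  proof -
    have "(\<integral>\<^sup>+z. indicator (k -` {n}) z * inverse (c n) \<partial>\<beta>) = c n * inverse (c n)"
      using cell[of n] by (subst nn_integral_multc) (auto simp: c_def borel_probsD[OF \<beta>] measurable_borel_probs[OF \<beta>])
    also have "\<dots> = 1" using that by (simp add: c_def ennreal_inverse_positive divide_ennreal_def[symmetric] ennreal_divide_self less_top[symmetric])
    finally show ?thesis .
  qed
  \<comment> \<open>The density lives on pairs whose middle points share a cell and normalizes by
    the mass of that cell: conditional independence given the cell. The value \<infinity> over null
    cells is met with probability zero.\<close>
  define h where "h w = (if k (snd (fst w)) = k (fst (snd w)) then inverse (c (k (snd (fst w)))) else 0)"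
    for w :: "('a \<times> 'z) \<times> 'z \<times> 'b"
  have h: "h \<in> borel_measurable (\<pi>1 \<Otimes>\<^sub>M \<pi>2)"
  proof -
    have k1: "(\<lambda>w. k (snd (fst w))) \<in> measurable (\<pi>1 \<Otimes>\<^sub>M \<pi>2) (count_space UNIV)"
      and k2: "(\<lambda>w. k (fst (snd w))) \<in> measurable (\<pi>1 \<Otimes>\<^sub>M \<pi>2) (count_space UNIV)"
      by (rule measurable_compose[OF _ k], measurable)+
    have [measurable]: "(\<lambda>w. real (k (snd (fst w)))) \<in> borel_measurable (\<pi>1 \<Otimes>\<^sub>M \<pi>2)"
      "(\<lambda>w. real (k (fst (snd w)))) \<in> borel_measurable (\<pi>1 \<Otimes>\<^sub>M \<pi>2)"
      using measurable_compose[OF k1, of real borel] measurable_compose[OF k2, of real borel] by simp_all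
    have [measurable]: "(\<lambda>w. inverse (c (k (snd (fst w))))) \<in> borel_measurable (\<pi>1 \<Otimes>\<^sub>M \<pi>2)"
      using measurable_compose[OF k1, of "\<lambda>n. inverse (c n)" borel] by simp
    have "h = (\<lambda>w. if real (k (snd (fst w))) = real (k (fst (snd w))) then inverse (c (k (snd (fst w)))) else 0)"
      by (simp add: h_def fun_eq_iff)
    also have "\<dots> \<in> borel_measurable (\<pi>1 \<Otimes>\<^sub>M \<pi>2)" by measurable
    finally show ?thesis .
  qed
  have "density (\<pi>1 \<Otimes>\<^sub>M \<pi>2) h \<in> couplings \<pi>1 \<pi>2"
  proof (rule density_pair_in_couplings[OF \<pi>1(2) \<pi>2(2) h])
    have im: "(\<lambda>z. indicator (k -` {n}) z * inverse (c n)) \<in> borel_measurable borel" for n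
      using cell[of n] by measurable
    have "AE w in \<pi>1. c (k (snd w)) \<noteq> 0"
    proof (rule AE_distrD[OF measurable_snd_borel[OF \<pi>1(2)]])
      show "AE z in distr \<pi>1 borel snd. c (k z) \<noteq> 0"
        by (subst couplingsD(3)[OF \<pi>1(1)]) (rule dens)
    qed
    then show "AE x in \<pi>1. (\<integral>\<^sup>+y. h (x, y) \<partial>\<pi>2) = 1"
    proof eventually_elim
      case (elim x)
      \<comment> \<open>For a fixed first point the section integral sees only the middle point of
        the second, whose law is \<open>\<beta>\<close>.\<close>
      let ?n = "k (snd x)"
      have "(\<integral>\<^sup>+y. h (x, y) \<partial>\<pi>2) = (\<integral>\<^sup>+y. indicator (k -` {?n}) (fst y) * inverse (c ?n) \<partial>\<pi>2)"
        by (intro nn_integral_cong) (auto simp: h_def)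
      also have "\<dots> = (\<integral>\<^sup>+z. indicator (k -` {?n}) z * inverse (c ?n) \<partial>distr \<pi>2 borel fst)"
        using im by (subst nn_integral_distr) simp_all
      finally show ?case using fib[OF elim] couplingsD(2)[OF \<pi>2(1)] by simp
    qed
    have "AE w in \<pi>2. c (k (fst w)) \<noteq> 0"
    proof (rule AE_distrD[OF measurable_fst_borel[OF \<pi>2(2)]])
      show "AE z in distr \<pi>2 borel fst. c (k z) \<noteq> 0"
        by (subst couplingsD(2)[OF \<pi>2(1)]) (rule dens)
    qed
    then show "AE y in \<pi>2. (\<integral>\<^sup>+x. h (x, y) \<partial>\<pi>1) = 1"
    proof eventually_elim
      case (elim y)
      let ?n = "k (fst y)"
      have "(\<integral>\<^sup>+x. h (x, y) \<partial>\<pi>1) = (\<integral>\<^sup>+x. indicator (k -` {?n}) (snd x) * inverse (c ?n) \<partial>\<pi>1)"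
        by (intro nn_integral_cong) (auto simp: h_def)
      also have "\<dots> = (\<integral>\<^sup>+z. indicator (k -` {?n}) z * inverse (c ?n) \<partial>distr \<pi>1 borel snd)"
        using im by (subst nn_integral_distr) simp_all
      finally show ?case using fib[OF elim] couplingsD(3)[OF \<pi>1(1)] by simp
    qed
  qed
  moreover have "AE w in density (\<pi>1 \<Otimes>\<^sub>M \<pi>2) h. dist (snd (fst w)) (fst (snd w)) \<le> \<delta>"
    using small by (subst AE_density[OF h]) (auto simp: h_def)
  ultimately show ?thesis using that by blast
qed

text \<open>The outer points of an approximate gluing form a coupling of \<open>\<mu>\<close> and
  \<open>\<nu>\<close>. Exchanging the copies of the middle points changes a structural distance by
  at most \<open>2 * \<delta>\<close>, since it has two endpoints; the feature error \<delta> is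
  enlarged to \<open>2 * \<delta>\<close> so that one constant serves both.\<close>

lemma fgw_energy_glue:
  fixes \<mu> :: "('x::polish_space \<times> 'o::polish_space) measure" and \<nu> :: "('y::polish_space \<times> 'o) measure"
    and \<beta> :: "('z::polish_space \<times> 'o) measure"
  assumes p: "p \<ge> 1" "q \<ge> 1" "0 < \<alpha>" "\<alpha> < 1"
    and \<mu>: "\<mu> \<in> borel_probs" and \<beta>: "\<beta> \<in> borel_probs"
    and \<pi>1: "\<pi>1 \<in> couplings \<mu> \<beta>" and \<pi>2: "\<pi>2 \<in> couplings \<beta> \<nu>"
    and F: "F > 0" "fgw_energy p q \<alpha> \<pi>1 \<le> ennreal (F powr (p * q))"
    and G: "G > 0" "fgw_energy p q \<alpha> \<pi>2 \<le> ennreal (G powr (p * q))" and d: "\<delta> > 0"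
  shows "(INF \<pi>\<in>couplings \<mu> \<nu>. fgw_energy p q \<alpha> \<pi>) \<le> ennreal ((F + (G + 2 * \<delta>)) powr (p * q))"
proof -
  note b1 = couplings_borel_probs[OF \<mu> \<pi>1] and b2 = couplings_borel_probs[OF \<beta> \<pi>2]
  let ?r = "p * q"
  have r: "?r \<ge> 1" using p mult_mono'[of 1 p 1 q] by simp
  obtain \<gamma> where \<gamma>c: "\<gamma> \<in> couplings \<pi>1 \<pi>2" and close: "AE w in \<gamma>. dist (snd (fst w)) (fst (snd w)) \<le> \<delta>"
    by (rule approximate_gluing[OF \<beta> \<pi>1 b1 \<pi>2 b2 d])
  have \<gamma>: "\<gamma> \<in> borel_probs" using couplings_borel_probs[OF b1 \<gamma>c] .
  interpret prob_space \<gamma> by (rule borel_probsD[OF \<gamma>])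
  have PP: "\<gamma> \<Otimes>\<^sub>M \<gamma> \<in> borel_probs" by (rule pair_borel_probs[OF \<gamma> \<gamma>])
  note fm = measurable_fst_borel[OF \<gamma>] and sm = measurable_snd_borel[OF \<gamma>]
  let ?g = "\<lambda>w :: (('x \<times> 'o) \<times> 'z \<times> 'o) \<times> ('z \<times> 'o) \<times> 'y \<times> 'o. (fst (fst w), snd (snd w))"
  have g: "?g \<in> borel_measurable \<gamma>"
    by (intro borel_measurable_Pair measurable_compose[OF fm fst_borel_measurable] measurable_compose[OF sm snd_borel_measurable])
  have "distr \<gamma> borel ?g \<in> couplings \<mu> \<nu>"
  proof -
    have "distr (distr \<gamma> borel ?g) borel fst = \<mu>"
      using couplingsD(2)[OF \<gamma>c] couplingsD(2)[OF \<pi>1]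
        distr_distr[OF fst_borel_measurable g] distr_distr[OF fst_borel_measurable fm] by (simp add: o_def)
    moreover have "distr (distr \<gamma> borel ?g) borel snd = \<nu>"
      using couplingsD(3)[OF \<gamma>c] couplingsD(3)[OF \<pi>2]
        distr_distr[OF snd_borel_measurable g] distr_distr[OF snd_borel_measurable sm] by (simp add: o_def)
    ultimately show ?thesis by (simp add: couplings_def)
  qed
  then have "(INF \<pi>\<in>couplings \<mu> \<nu>. fgw_energy p q \<alpha> \<pi>) \<le> fgw_energy p q \<alpha> (distr \<gamma> borel ?g)"
    by (rule INF_lower)
  also have "\<dots> \<le> ennreal ((F + (G + 2 * \<delta>)) powr ?r)"
  proof -
    \<comment> \<open>\<open>f1\<close> and \<open>f2\<close> are the weighted norms that belong to
      \<open>\<pi>1\<close> and \<open>\<pi>2\<close>, read on one space; \<open>F\<close> and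
      \<open>G\<close> bound their \<open>p * q\<close>-norms. The constant
      \<open>2 * \<delta>\<close> has norm \<open>2 * \<delta>\<close> there, because the total mass
      is 1.\<close>
    define f1 where "f1 z = weighted_norm q \<alpha> (dist (snd (fst (fst (fst z)))) (snd (snd (fst (fst z)))))
       \<bar>dist (fst (fst (fst (fst z)))) (fst (fst (fst (snd z)))) - dist (fst (snd (fst (fst z)))) (fst (snd (fst (snd z))))\<bar>"
      for z :: "((('x \<times> 'o) \<times> 'z \<times> 'o) \<times> ('z \<times> 'o) \<times> 'y \<times> 'o) \<times> (('x \<times> 'o) \<times> 'z \<times> 'o) \<times> ('z \<times> 'o) \<times> 'y \<times> 'o"
    define f2 where "f2 z = weighted_norm q \<alpha> (dist (snd (fst (snd (fst z)))) (snd (snd (snd (fst z)))))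
       \<bar>dist (fst (fst (snd (fst z)))) (fst (fst (snd (snd z)))) - dist (fst (snd (snd (fst z)))) (fst (snd (snd (snd z))))\<bar>"
      for z :: "((('x \<times> 'o) \<times> 'z \<times> 'o) \<times> ('z \<times> 'o) \<times> 'y \<times> 'o) \<times> (('x \<times> 'o) \<times> 'z \<times> 'o) \<times> ('z \<times> 'o) \<times> 'y \<times> 'o"
    have cont: "continuous_on UNIV f1" "continuous_on UNIV f2"
      unfolding f1_def f2_def weighted_norm_def
      using p by (intro continuous_on_powr' continuous_intros ballI; auto)+
    then have meas[measurable]: "f1 \<in> borel_measurable (\<gamma> \<Otimes>\<^sub>M \<gamma>)" "f2 \<in> borel_measurable (\<gamma> \<Otimes>\<^sub>M \<gamma>)"
      by (simp_all add: measurable_borel_probs[OF PP] borel_measurable_continuous_onI)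
    have nn: "0 \<le> f1 z" "0 \<le> f2 z" for z by (simp_all add: f1_def f2_def weighted_norm_nonneg)
    have e1: "(\<integral>\<^sup>+z. ennreal (f1 z powr ?r) \<partial>(\<gamma> \<Otimes>\<^sub>M \<gamma>)) \<le> ennreal (F powr ?r)"
      using F(2) fgw_energy_distr[OF p \<gamma> fm] couplingsD(2)[OF \<gamma>c]
      by (simp add: fgw_cost_weighted_norm[OF p(2-4)] f1_def)
    have e2: "(\<integral>\<^sup>+z. ennreal (f2 z powr ?r) \<partial>(\<gamma> \<Otimes>\<^sub>M \<gamma>)) \<le> ennreal (G powr ?r)"
      using G(2) fgw_energy_distr[OF p \<gamma> sm] couplingsD(3)[OF \<gamma>c]
      by (simp add: fgw_cost_weighted_norm[OF p(2-4)] f2_def)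
    have "(\<integral>\<^sup>+z. ennreal ((f2 z + 2 * \<delta>) powr ?r) \<partial>(\<gamma> \<Otimes>\<^sub>M \<gamma>)) \<le> ennreal ((G + 2 * \<delta>) powr ?r)"
      using d G r e2 nn prob_space.emeasure_space_1[OF borel_probsD(1)[OF PP]]
      by (intro nn_integral_Minkowski[OF r]) auto
    then have M: "(\<integral>\<^sup>+z. ennreal ((f1 z + (f2 z + 2 * \<delta>)) powr ?r) \<partial>(\<gamma> \<Otimes>\<^sub>M \<gamma>)) \<le> ennreal ((F + (G + 2 * \<delta>)) powr ?r)"
      using d F G nn e1 by (rule_tac nn_integral_Minkowski[OF r meas(1)]) auto
    have close1: "AE z in \<gamma> \<Otimes>\<^sub>M \<gamma>. dist (snd (fst (fst z))) (fst (snd (fst z))) \<le> \<delta>"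
    proof (rule AE_distrD[OF measurable_fst_borel[OF PP]])
      show "AE w in distr (\<gamma> \<Otimes>\<^sub>M \<gamma>) borel fst. dist (snd (fst w)) (fst (snd w)) \<le> \<delta>"
        by (subst distr_borel_pair_fst[OF \<gamma> \<gamma>]) (rule close)
    qed
    have close2: "AE z in \<gamma> \<Otimes>\<^sub>M \<gamma>. dist (snd (fst (snd z))) (fst (snd (snd z))) \<le> \<delta>"
    proof (rule AE_distrD[OF measurable_snd_borel[OF PP]])
      show "AE w in distr (\<gamma> \<Otimes>\<^sub>M \<gamma>) borel snd. dist (snd (fst w)) (fst (snd w)) \<le> \<delta>"
        by (subst distr_borel_pair_snd[OF \<gamma> \<gamma>]) (rule close)
    qed
    have "fgw_energy p q \<alpha> (distr \<gamma> borel ?g) \<le> (\<integral>\<^sup>+z. ennreal ((f1 z + (f2 z + 2 * \<delta>)) powr ?r) \<partial>(\<gamma> \<Otimes>\<^sub>M \<gamma>))"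
      unfolding fgw_energy_distr[OF p \<gamma> g]
    proof (rule nn_integral_mono_AE)
      show "AE z in \<gamma> \<Otimes>\<^sub>M \<gamma>. ennreal (fgw_cost p q \<alpha> (?g (fst z)) (?g (snd z)))
         \<le> ennreal ((f1 z + (f2 z + 2 * \<delta>)) powr ?r)"
        using close1 close2
      proof eventually_elim
        case (elim z)
        obtain x a z1 c1 z2 c2 y b x' a' z1' c1' z2' c2' y' b' where z:
          "z = ((((x, a), z1, c1), (z2, c2), y, b), (((x', a'), z1', c1'), (z2', c2'), y', b'))"
          by (metis prod.collapse)
        have le: "dist z1 z2 \<le> \<delta>" "dist c1 c2 \<le> \<delta>" "dist z1' z2' \<le> \<delta>"
          using elim dist_fst_le[of "(z1, c1)" "(z2, c2)"] dist_snd_le[of "(z1, c1)" "(z2, c2)"]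
            dist_fst_le[of "(z1', c1')" "(z2', c2')"] by (auto simp: z)
        have u: "dist a b \<le> dist a c1 + (dist c2 b + 2 * \<delta>)"
          using dist_triangle[of a b c1] dist_triangle[of c1 b c2] le(2) d by linarith
        have v: "\<bar>dist x x' - dist y y'\<bar> \<le> \<bar>dist x x' - dist z1 z1'\<bar> + (\<bar>dist z2 z2' - dist y y'\<bar> + 2 * \<delta>)"
        proof -
          have "dist z1 z1' \<le> dist z2 z2' + 2 * \<delta>" "dist z2 z2' \<le> dist z1 z1' + 2 * \<delta>"
            using dist_triangle[of z1 z1' z2] dist_triangle[of z2 z1' z2'] dist_triangle[of z2 z2' z1]
              dist_triangle[of z1 z2' z1'] le by (simp_all add: dist_commute)
          then show ?thesis by linarith
        qed
        \<comment> \<open>Monotonicity passes to the coordinatewise bounds; the triangle inequality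
          of the norm then separates the two couplings and the error.\<close>
        have "weighted_norm q \<alpha> (dist a b) \<bar>dist x x' - dist y y'\<bar> \<le>
          weighted_norm q \<alpha> (dist a c1 + (dist c2 b + 2 * \<delta>)) (\<bar>dist x x' - dist z1 z1'\<bar> + (\<bar>dist z2 z2' - dist y y'\<bar> + 2 * \<delta>))"
          using u v by (intro weighted_norm_mono p) auto
        also have "\<dots> \<le> weighted_norm q \<alpha> (dist a c1) \<bar>dist x x' - dist z1 z1'\<bar> +
          weighted_norm q \<alpha> (dist c2 b + 2 * \<delta>) (\<bar>dist z2 z2' - dist y y'\<bar> + 2 * \<delta>)"
          using d by (intro weighted_norm_add p) auto
        also have "weighted_norm q \<alpha> (dist c2 b + 2 * \<delta>) (\<bar>dist z2 z2' - dist y y'\<bar> + 2 * \<delta>) \<le>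
          weighted_norm q \<alpha> (dist c2 b) \<bar>dist z2 z2' - dist y y'\<bar> + weighted_norm q \<alpha> (2 * \<delta>) (2 * \<delta>)"
          using d by (intro weighted_norm_add p) auto
        also have "weighted_norm q \<alpha> (2 * \<delta>) (2 * \<delta>) = 2 * \<delta>"
          using d p by (intro weighted_norm_diag) auto
        finally have "weighted_norm q \<alpha> (dist a b) \<bar>dist x x' - dist y y'\<bar> \<le> f1 z + (f2 z + 2 * \<delta>)"
          by (simp add: f1_def f2_def z)
        then have "weighted_norm q \<alpha> (dist a b) \<bar>dist x x' - dist y y'\<bar> powr ?r \<le> (f1 z + (f2 z + 2 * \<delta>)) powr ?r"
          using r weighted_norm_nonneg by (intro powr_mono2) auto
        then show ?case by (simp add: fgw_cost_weighted_norm[OF p(2-4)] z ennreal_leI)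
      qed
    qed
    then show ?thesis using M by (rule order_trans)
  qed
  finally show ?thesis .
qed

lemma ennreal_power_ennreal: "0 \<le> e \<Longrightarrow> ennreal_power (ennreal e) s = ennreal (e powr s)"
  by (simp add: ennreal_power_def)

text \<open>Finiteness of the three infima lets the argument run in the reals, on their roots of
  order \<open>p * q\<close>. For \<open>q = 1\<close> the factor is 1, so both forms of the
  inequality come from this one statement.\<close>

lemma FGW_triangle:
  fixes \<mu> :: "('x::polish_space \<times> 'o::polish_space) measure" and \<nu> :: "('y::polish_space \<times> 'o) measure"
    and \<beta> :: "('z::polish_space \<times> 'o) measure"
  assumes p: "p \<ge> 1" "q \<ge> 1" "0 < \<alpha>" "\<alpha> < 1"
    and \<mu>: "\<mu> \<in> structured_objects (p * q)" and \<nu>: "\<nu> \<in> structured_objects (p * q)"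
    and \<beta>: "\<beta> \<in> structured_objects (p * q)"
  shows "FGW \<alpha> p q \<mu> \<nu> \<le> ennreal (2 powr (q - 1)) * (FGW \<alpha> p q \<mu> \<beta> + FGW \<alpha> p q \<beta> \<nu>)"
proof -
  note b = \<mu>[THEN structured_objects_borel_probs] \<nu>[THEN structured_objects_borel_probs] \<beta>[THEN structured_objects_borel_probs]
  let ?r = "p * q"
  have r: "?r \<ge> 1" using p mult_mono'[of 1 p 1 q] by simp
  define I where "I = (INF \<pi>\<in>couplings \<mu> \<nu>. fgw_energy p q \<alpha> \<pi>)"
  define I1 where "I1 = (INF \<pi>\<in>couplings \<mu> \<beta>. fgw_energy p q \<alpha> \<pi>)"
  define I2 where "I2 = (INF \<pi>\<in>couplings \<beta> \<nu>. fgw_energy p q \<alpha> \<pi>)"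
  have "I < \<infinity>" "I1 < \<infinity>" "I2 < \<infinity>"
    unfolding I_def I1_def I2_def
    using INF_lower[OF pair_in_couplings[OF b(1,2)], of "fgw_energy p q \<alpha>"] fgw_energy_finite[OF p \<mu> \<nu> pair_in_couplings[OF b(1,2)]]
      INF_lower[OF pair_in_couplings[OF b(1,3)], of "fgw_energy p q \<alpha>"] fgw_energy_finite[OF p \<mu> \<beta> pair_in_couplings[OF b(1,3)]]
      INF_lower[OF pair_in_couplings[OF b(3,2)], of "fgw_energy p q \<alpha>"] fgw_energy_finite[OF p \<beta> \<nu> pair_in_couplings[OF b(3,2)]]
    by (blast intro: order_le_less_trans)+
  then obtain e e1 e2 where e: "I = ennreal e" "I1 = ennreal e1" "I2 = ennreal e2" and nn: "0 \<le> e" "0 \<le> e1" "0 \<le> e2"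
    by (auto simp: less_top_ennreal)
  let ?s = "e1 powr (1 / ?r) + e2 powr (1 / ?r)"
  have "e powr (1 / ?r) \<le> ?s"
  proof (rule field_le_epsilon)
    fix \<epsilon> :: real assume eps: "\<epsilon> > 0"
    \<comment> \<open>\<delta> is spent four times: once for each near-optimal coupling and twice in
      the gluing.\<close>
    define \<delta> where "\<delta> = \<epsilon> / 4"
    have d: "\<delta> > 0" using eps by (simp add: \<delta>_def)
    \<comment> \<open>The surplus \<delta> keeps the norm bounds strictly positive even when an
      infimum is zero, which is why near-optimal couplings are used and not optimal ones.\<close>
    have app: "\<exists>\<pi>\<in>A. E \<pi> \<le> ennreal ((f powr (1 / ?r) + \<delta>) powr ?r)"
      if "(INF \<pi>\<in>A. E \<pi>) = ennreal f" "0 \<le> f" for A f and E :: "'t measure \<Rightarrow> ennreal"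
    proof -
      have "f = (f powr (1 / ?r)) powr ?r" using that(2) p by (auto simp: powr_powr)
      also have "\<dots> < (f powr (1 / ?r) + \<delta>) powr ?r" using d r by (intro powr_less_mono2) auto
      finally have "(INF \<pi>\<in>A. E \<pi>) < ennreal ((f powr (1 / ?r) + \<delta>) powr ?r)"
        using that by (simp add: ennreal_less_iff)
      then show ?thesis by (auto simp: INF_less_iff intro: less_imp_le)
    qed
    obtain \<pi>1 where 1: "\<pi>1 \<in> couplings \<mu> \<beta>" "fgw_energy p q \<alpha> \<pi>1 \<le> ennreal ((e1 powr (1 / ?r) + \<delta>) powr ?r)"
      using app[OF e(2)[unfolded I1_def] nn(2)] by blast
    obtain \<pi>2 where 2: "\<pi>2 \<in> couplings \<beta> \<nu>" "fgw_energy p q \<alpha> \<pi>2 \<le> ennreal ((e2 powr (1 / ?r) + \<delta>) powr ?r)"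
      using app[OF e(3)[unfolded I2_def] nn(3)] by blast
    have "I \<le> ennreal (((e1 powr (1 / ?r) + \<delta>) + ((e2 powr (1 / ?r) + \<delta>) + 2 * \<delta>)) powr ?r)"
      unfolding I_def using d by (intro fgw_energy_glue[OF p b(1,3) 1(1) 2(1) _ 1(2) _ 2(2) d]) (auto intro: add_nonneg_pos)
    also have "(e1 powr (1 / ?r) + \<delta>) + ((e2 powr (1 / ?r) + \<delta>) + 2 * \<delta>) = ?s + \<epsilon>" by (simp add: \<delta>_def)
    finally have "e \<le> (?s + \<epsilon>) powr ?r" using nn by (simp add: e)
    then have "e powr (1 / ?r) \<le> ((?s + \<epsilon>) powr ?r) powr (1 / ?r)" using nn r by (intro powr_mono2) auto
    also have "\<dots> = ?s + \<epsilon>" using eps p by (auto simp: powr_powr add_nonneg_nonneg)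
    finally show "e powr (1 / ?r) \<le> ?s + \<epsilon>" .
  qed
  then have "(e powr (1 / ?r)) powr q \<le> ?s powr q" using p by (intro powr_mono2) auto
  \<comment> \<open>The convexity bound with \<open>F = G = 1\<close>; its constant is
    \<open>2 powr q / 2\<close>.\<close>
  also have "\<dots> \<le> 2 powr (q - 1) * ((e1 powr (1 / ?r)) powr q + (e2 powr (1 / ?r)) powr q)"
    using powr_add_le[OF p(2), of "e1 powr (1 / ?r)" "e2 powr (1 / ?r)" 1 1] by (simp add: powr_diff field_simps)
  finally have "e powr (1 / p) \<le> 2 powr (q - 1) * (e1 powr (1 / p) + e2 powr (1 / p))"
    using p by (simp add: powr_powr)
  then show ?thesis
    unfolding FGW_def I_def[symmetric] I1_def[symmetric] I2_def[symmetric] e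
    using nn by (simp add: ennreal_power_ennreal ennreal_leI flip: ennreal_mult ennreal_plus)
qed

section \<open>Supports and isometries\<close>

lemma closed_msupport: "closed (msupport M)"
  unfolding msupport_def by (intro closed_Inter) auto

lemma msupport_subset: "closed C \<Longrightarrow> emeasure M (- C) = 0 \<Longrightarrow> msupport M \<subseteq> C"
  unfolding msupport_def by auto

lemma in_msupport_iff: "x \<in> msupport M \<longleftrightarrow> (\<forall>U. open U \<longrightarrow> x \<in> U \<longrightarrow> emeasure M U \<noteq> 0)"
proof
  assume x: "x \<in> msupport M"
  show "\<forall>U. open U \<longrightarrow> x \<in> U \<longrightarrow> emeasure M U \<noteq> 0"
  proof (intro allI impI notI)
    fix U assume "open U" "x \<in> U" "emeasure M U = 0"
    then have "msupport M \<subseteq> - U" by (intro msupport_subset) auto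
    with x \<open>x \<in> U\<close> show False by auto
  qed
next
  assume *: "\<forall>U. open U \<longrightarrow> x \<in> U \<longrightarrow> emeasure M U \<noteq> 0"
  show "x \<in> msupport M"
    unfolding msupport_def using * by (auto simp: closed_def)
qed

text \<open>The complement is a union of open null sets, and by Lindelof countably many of them
  suffice.\<close>

lemma emeasure_Compl_msupport:
  fixes M :: "'a::second_countable_topology measure"
  assumes M: "M \<in> borel_probs"
  shows "emeasure M (- msupport M) = 0"
proof -
  let ?F = "{U. open U \<and> emeasure M U = 0}"
  obtain F where F: "F \<subseteq> ?F" "countable F" "\<Union>F = \<Union>?F"
    using Lindelof[of ?F] by auto
  have "- msupport M = \<Union>?F"
    unfolding msupport_def by (auto simp: closed_def) (metis Compl_iff double_compl)
  also have "\<dots> = (\<Union>U\<in>F. U)" using F(3) by simp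
  also have "emeasure M \<dots> = 0"
  proof (rule null_setsD1, rule null_sets_UN'[OF F(2)])
    show "U \<in> null_sets M" if "U \<in> F" for U
      using that F(1) by (intro null_setsI) (auto simp: borel_probsD[OF M])
  qed
  finally show ?thesis .
qed

lemma AE_in_msupport:
  fixes M :: "'a::second_countable_topology measure"
  assumes M: "M \<in> borel_probs"
  shows "AE x in M. x \<in> msupport M"
  using emeasure_Compl_msupport[OF M] closed_msupport[of M] borel_probsD(4)[OF M]
  by (intro AE_I[where N="- msupport M"]) auto

lemma msupport_AE_closed:
  assumes M: "M \<in> borel_probs" and "closed C" and AE: "AE x in M. x \<in> C"
  shows "msupport M \<subseteq> C"
proof (rule msupport_subset)
  show "emeasure M (- C) = 0"
    using AE borel_probsD[OF M] \<open>closed C\<close>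
    by (subst (asm) AE_iff_measurable[of "- C"]) auto
qed fact

lemma msupport_distr:
  assumes M: "M \<in> borel_probs" and f: "continuous_on UNIV f" and x: "x \<in> msupport M"
  shows "f x \<in> msupport (distr M borel f)"
  unfolding in_msupport_iff
proof (intro allI impI)
  fix U assume U: "open U" "f x \<in> U"
  have m: "f \<in> borel_measurable M"
    using borel_measurable_continuous_onI[OF f] by (simp add: measurable_borel_probs[OF M])
  have "open (f -` U)" using U(1) f by (simp add: open_vimage continuous_on_open_vimage)
  then have "emeasure M (f -` U) \<noteq> 0" using x U(2) by (simp add: in_msupport_iff)
  then show "emeasure (distr M borel f) U \<noteq> 0"
    using U m by (simp add: emeasure_distr borel_probsD[OF M])
qed

section \<open>Maps on supports and isometric couplings\<close>

text \<open>Extending \<open>f\<close> by a constant off the full-measure set \<open>S\<close> gives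
  a total map with the same image measure, to which the composition rules for \<open>distr\<close>
  apply.\<close>

lemma push_forward_on_iff:
  fixes M :: "'a::topological_space measure" and N :: "'b::topological_space measure"
  assumes M: "M \<in> borel_probs" and N: "sets N = sets borel" and S: "closed S" "AE x in M. x \<in> S"
  shows "push_forward_on S f M N \<longleftrightarrow>
    (\<lambda>x. if x \<in> S then f x else c) \<in> borel_measurable M \<and> distr M borel (\<lambda>x. if x \<in> S then f x else c) = N"
proof -
  let ?g = "\<lambda>x. if x \<in> S then f x else c"
  have SM: "S \<inter> space M \<in> sets M" using S by (simp add: borel_probsD[OF M])
  have eq: "f \<in> measurable (restrict_space M S) N \<longleftrightarrow> ?g \<in> borel_measurable M"
    using measurable_restrict_space_iff[OF SM, of c N f] sets_eq_imp_space_eq[OF N]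
    by (simp add: measurable_cong_sets[OF refl N])
  have "distr (restrict_space M S) N f = distr M borel ?g" if g: "?g \<in> borel_measurable M"
  proof (rule measure_eqI)
    show "sets (distr (restrict_space M S) N f) = sets (distr M borel ?g)" by (simp add: N)
    fix A assume "A \<in> sets (distr (restrict_space M S) N f)"
    then have A: "A \<in> sets N" "A \<in> sets borel" by (simp_all add: N)
    have fm: "f \<in> measurable (restrict_space M S) N" using eq g by simp
    have "emeasure (distr (restrict_space M S) N f) A = emeasure (restrict_space M S) (f -` A \<inter> space (restrict_space M S))"
      by (rule emeasure_distr[OF fm A(1)])
    also have "\<dots> = emeasure M (f -` A \<inter> space (restrict_space M S))"
      using SM by (intro emeasure_restrict_space) (auto simp: space_restrict_space)
    also have "\<dots> = emeasure M (?g -` A \<inter> space M)"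
    proof (rule emeasure_eq_AE)
      show "AE x in M. (x \<in> f -` A \<inter> space (restrict_space M S)) = (x \<in> ?g -` A \<inter> space M)"
        using S(2) by eventually_elim (auto simp: space_restrict_space)
      show "?g -` A \<inter> space M \<in> sets M" using measurable_sets[OF g A(2)] .
      have "f -` A \<inter> space (restrict_space M S) \<in> sets (restrict_space M S)"
        using measurable_sets[OF fm A(1)] .
      then show "f -` A \<inter> space (restrict_space M S) \<in> sets M"
        using SM by (simp add: sets_restrict_space_iff)
    qed
    also have "\<dots> = emeasure (distr M borel ?g) A" using g A by (simp add: emeasure_distr)
    finally show "emeasure (distr (restrict_space M S) N f) A = emeasure (distr M borel ?g) A" .
  qed
  then show ?thesis using eq by (auto simp: push_forward_on_def)
qed

lemma push_forward_on_cong: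
  assumes "\<And>x. x \<in> S \<Longrightarrow> f x = g x"
  shows "push_forward_on S f M N = push_forward_on S g M N"
proof -
  have "f \<in> measurable (restrict_space M S) N \<longleftrightarrow> g \<in> measurable (restrict_space M S) N"
    using assms by (intro measurable_cong) (simp add: space_restrict_space)
  moreover have "distr (restrict_space M S) N f = distr (restrict_space M S) N g"
    using assms by (intro distr_cong) (auto simp: space_restrict_space)
  ultimately show ?thesis by (simp add: push_forward_on_def)
qed

text \<open>If first components converge, the isometry makes the second components Cauchy;
  completeness gives them a limit, and closedness of \<open>R\<close> keeps the limit pair in
  \<open>R\<close>. Projections of arbitrary closed sets need not be closed.\<close>

lemma closed_fst_image:
  fixes R :: "('a::metric_space \<times> 'b::complete_space) set"
  assumes "closed R" and iso: "\<And>w w'. w \<in> R \<Longrightarrow> w' \<in> R \<Longrightarrow> dist (fst w) (fst w') = dist (snd w) (snd w')"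
  shows "closed (fst ` R)"
  unfolding closed_sequential_limits
proof (intro allI impI, elim conjE)
  fix u l assume u: "\<forall>n. u n \<in> fst ` R" and lim: "u \<longlonglongrightarrow> l"
  from u have "\<forall>n. \<exists>v. (u n, v) \<in> R" by force
  then obtain v where v: "\<And>n. (u n, v n) \<in> R" by metis
  have "Cauchy u" using lim by (simp add: LIMSEQ_imp_Cauchy)
  then have "Cauchy v" using iso[OF v v] by (simp add: Cauchy_def)
  then obtain m where "v \<longlonglongrightarrow> m" by (auto simp: Cauchy_convergent_iff convergent_def)
  with lim have "(\<lambda>n. (u n, v n)) \<longlonglongrightarrow> (l, m)" by (rule tendsto_Pair)
  with \<open>closed R\<close> v have "(l, m) \<in> R" by (rule closed_sequentially)
  then show "l \<in> fst ` R" by force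
qed

lemma closed_snd_image:
  fixes R :: "('a::complete_space \<times> 'b::metric_space) set"
  assumes "closed R" and iso: "\<And>w w'. w \<in> R \<Longrightarrow> w' \<in> R \<Longrightarrow> dist (fst w) (fst w') = dist (snd w) (snd w')"
  shows "closed (snd ` R)"
proof -
  have "closed (prod.swap -` R)"
    using \<open>closed R\<close> unfolding prod.swap_def by (intro closed_vimage continuous_intros)
  then have "closed (fst ` (prod.swap -` R))"
    using iso by (intro closed_fst_image) fastforce+
  moreover have "fst ` (prod.swap -` R) = snd ` R"
  proof (intro subset_antisym subsetI)
    fix x assume "x \<in> fst ` (prod.swap -` R)"
    then obtain y where "(y, x) \<in> R" by auto
    then show "x \<in> snd ` R" by (rule rev_image_eqI) simp
  next
    fix x assume "x \<in> snd ` R"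
    then obtain y where "(x, y) \<in> prod.swap -` R" by auto
    then show "x \<in> fst ` (prod.swap -` R)" by (rule rev_image_eqI) simp
  qed
  ultimately show ?thesis by simp
qed

text \<open>A pair of support points outside \<open>C\<close> has a rectangular neighbourhood
  outside \<open>C\<close>, whose mass is a product of two positive masses. So an almost sure closed
  relation holds everywhere on the support.\<close>

lemma msupport_pair_in_closed:
  fixes M :: "'a::second_countable_topology measure"
  assumes M: "M \<in> borel_probs" and AE: "AE z in M \<Otimes>\<^sub>M M. z \<in> C" and C: "closed C"
    and "w \<in> msupport M" "w' \<in> msupport M"
  shows "(w, w') \<in> C"
proof (rule ccontr)
  assume "(w, w') \<notin> C"
  then obtain U V where UV: "open U" "open V" "w \<in> U" "w' \<in> V" "U \<times> V \<subseteq> - C"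
    using C by (metis Compl_iff mem_Sigma_iff open_Compl open_prod_elim)
  interpret prob_space M by (rule borel_probsD[OF M])
  have "emeasure (M \<Otimes>\<^sub>M M) (U \<times> V) = emeasure M U * emeasure M V"
    using UV by (intro emeasure_pair_measure_Times) (simp_all add: borel_probsD[OF M])
  moreover have "emeasure M U \<noteq> 0" "emeasure M V \<noteq> 0"
    using UV assms by (simp_all add: in_msupport_iff)
  moreover have "emeasure (M \<Otimes>\<^sub>M M) (U \<times> V) = 0"
  proof -
    have sets: "U \<times> V \<in> sets (M \<Otimes>\<^sub>M M)" using UV by (simp add: borel_probsD[OF M])
    have "AE z in M \<Otimes>\<^sub>M M. z \<notin> U \<times> V" using AE by eventually_elim (use UV(5) in auto)
    then show ?thesis using sets AE_iff_null_sets by blast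
  qed
  ultimately show False by simp
qed

text \<open>The support of a coupling that preserves distances almost surely is the graph of an isometry;
  completeness is what makes its projections closed, hence equal to the full supports.\<close>

lemma isometric_coupling:
  fixes M :: "'a::polish_space measure" and N :: "'b::polish_space measure"
  assumes M: "M \<in> borel_probs" and N: "N \<in> borel_probs" and c: "\<pi> \<in> couplings M N"
    and AE: "AE z in \<pi> \<Otimes>\<^sub>M \<pi>. dist (fst (fst z)) (fst (snd z)) = dist (snd (fst z)) (snd (snd z))"
  obtains \<phi> where "bij_betw \<phi> (msupport M) (msupport N)" "push_forward_on (msupport M) \<phi> M N"
    "\<And>z z'. z \<in> msupport M \<Longrightarrow> z' \<in> msupport M \<Longrightarrow> dist z z' = dist (\<phi> z) (\<phi> z')"
    "\<And>z. z \<in> msupport M \<Longrightarrow> (z, \<phi> z) \<in> msupport \<pi>" "\<And>z v. (z, v) \<in> msupport \<pi> \<Longrightarrow> z \<in> msupport M \<and> v = \<phi> z"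
proof -
  have \<pi>: "\<pi> \<in> borel_probs" by (rule couplings_borel_probs[OF M c])
  let ?R = "msupport \<pi>"
  have iso: "dist (fst w) (fst w') = dist (snd w) (snd w')" if "w \<in> ?R" "w' \<in> ?R" for w w'
  proof -
    have "closed {z :: ('a \<times> 'b) \<times> 'a \<times> 'b. dist (fst (fst z)) (fst (snd z)) = dist (snd (fst z)) (snd (snd z))}"
      by (intro closed_Collect_eq continuous_intros)
    from msupport_pair_in_closed[OF \<pi> _ this that] AE show ?thesis by simp
  qed
  have Rc: "closed ?R" by (rule closed_msupport)
  have dM: "distr \<pi> borel fst = M" and dN: "distr \<pi> borel snd = N" using couplingsD[OF c] by auto
  have fm: "fst \<in> borel_measurable \<pi>" and sm: "snd \<in> borel_measurable \<pi>"
    using measurable_fst_borel[OF \<pi>] measurable_snd_borel[OF \<pi>] .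
  have fst_R: "fst ` ?R = msupport M"
  proof
    show "fst ` ?R \<subseteq> msupport M"
      using msupport_distr[OF \<pi> continuous_on_fst[OF continuous_on_id]] dM by auto
    \<comment> \<open>The projection is closed and carries full measure, so it contains the smallest
      such set.\<close>
    show "msupport M \<subseteq> fst ` ?R"
    proof (rule msupport_AE_closed[OF M closed_fst_image[OF Rc iso]])
      have "closed (fst ` ?R)" by (rule closed_fst_image[OF Rc iso])
      then have "(AE x in distr \<pi> borel fst. x \<in> fst ` ?R) \<longleftrightarrow> (AE w in \<pi>. fst w \<in> fst ` ?R)"
        using fm by (intro AE_distr_iff) auto
      then show "AE x in M. x \<in> fst ` ?R"
        using AE_in_msupport[OF \<pi>] unfolding dM by (metis (mono_tags, lifting) eventually_mono imageI)
    qed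
  qed
  have snd_R: "snd ` ?R = msupport N"
  proof
    show "snd ` ?R \<subseteq> msupport N"
      using msupport_distr[OF \<pi> continuous_on_snd[OF continuous_on_id]] dN by auto
    show "msupport N \<subseteq> snd ` ?R"
    proof (rule msupport_AE_closed[OF N closed_snd_image[OF Rc iso]])
      have "closed (snd ` ?R)" by (rule closed_snd_image[OF Rc iso])
      then have "(AE x in distr \<pi> borel snd. x \<in> snd ` ?R) \<longleftrightarrow> (AE w in \<pi>. snd w \<in> snd ` ?R)"
        using sm by (intro AE_distr_iff) auto
      then show "AE x in N. x \<in> snd ` ?R"
        using AE_in_msupport[OF \<pi>] unfolding dN by (metis (mono_tags, lifting) eventually_mono imageI)
    qed
  qed
  define \<phi> where "\<phi> z = (SOME v. (z, v) \<in> ?R)" for z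
  have graph: "(z, \<phi> z) \<in> ?R" if "z \<in> msupport M" for z
  proof -
    have "\<exists>v. (z, v) \<in> ?R" using that fst_R by force
    then show ?thesis unfolding \<phi>_def by (rule someI_ex)
  qed
  have unique: "z \<in> msupport M \<and> v = \<phi> z" if "(z, v) \<in> ?R" for z v
  proof -
    have z: "z \<in> msupport M" using that fst_R by force
    \<comment> \<open>Both points lie over \<open>z\<close>, so their second components have
      distance 0.\<close>
    show ?thesis using iso[OF that graph[OF z]] z by simp
  qed
  have dist: "dist z z' = dist (\<phi> z) (\<phi> z')" if "z \<in> msupport M" "z' \<in> msupport M" for z z'
    using iso[OF graph graph, OF that] by simp
  have bij: "bij_betw \<phi> (msupport M) (msupport N)"
    unfolding bij_betw_def
  proof
    show "inj_on \<phi> (msupport M)" using dist by (intro inj_onI) (metis dist_eq_0_iff)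
    show "\<phi> ` msupport M = msupport N"
    proof (intro subset_antisym subsetI)
      fix v assume "v \<in> \<phi> ` msupport M"
      then obtain z where "z \<in> msupport M" "v = \<phi> z" by auto
      then have "snd (z, v) \<in> snd ` ?R" using graph by blast
      then show "v \<in> msupport N" using snd_R by simp
    next
      fix v assume "v \<in> msupport N"
      then obtain z where "(z, v) \<in> ?R" using snd_R by force
      then show "v \<in> \<phi> ` msupport M" using unique by blast
    qed
  qed
  \<comment> \<open>\<open>\<phi>\<close> was picked by choice; its measurability comes from being
    an isometry on a closed set.\<close>
  have "continuous_on (msupport M) \<phi>"
    unfolding continuous_on_iff
  proof (intro ballI allI impI)
    fix x e assume "x \<in> msupport M" "(0::real) < e"
    then show "\<exists>d>0. \<forall>x'\<in>msupport M. dist x' x < d \<longrightarrow> dist (\<phi> x') (\<phi> x) < e"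
      using dist by (intro exI[of _ e]) auto
  qed
  then have "\<phi> \<in> borel_measurable (restrict_space borel (msupport M))"
    by (rule borel_measurable_continuous_on_restrict)
  moreover have cM: "closed (msupport M)" by (rule closed_msupport)
  ultimately have "(\<lambda>x. if x \<in> msupport M then \<phi> x else undefined) \<in> borel_measurable borel"
    by (subst (asm) measurable_restrict_space_iff[where c=undefined]) auto
  then have g: "(\<lambda>x. if x \<in> msupport M then \<phi> x else undefined) \<in> borel_measurable M" (is "?g \<in> _")
    by (simp add: measurable_borel_probs[OF M])
  \<comment> \<open>\<open>M\<close> is the law of \<open>fst\<close> under \<open>\<pi>\<close>,
    and \<open>?g\<close> almost surely maps the first component to the second; so the image law is
    that of \<open>snd\<close>.\<close>
  have "distr M borel ?g = distr \<pi> borel (?g \<circ> fst)"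
    unfolding dM[symmetric] using g by (intro distr_distr fm) (simp add: dM measurable_borel_probs[OF M])
  also have "\<dots> = distr \<pi> borel snd"
  proof (rule distr_cong_AE)
    show "AE w in \<pi>. (?g \<circ> fst) w = snd w"
      using AE_in_msupport[OF \<pi>] by eventually_elim (use unique in \<open>auto simp: prod_eq_iff\<close>)
    show "?g \<circ> fst \<in> borel_measurable \<pi>"
      using g by (intro measurable_comp[OF fm]) (simp add: measurable_borel_probs[OF M])
  qed (simp_all add: sm)
  finally have "push_forward_on (msupport M) \<phi> M N"
    using g dN by (subst push_forward_on_iff[OF M borel_probsD(4)[OF N] cM AE_in_msupport[OF M]]) auto
  from that[OF bij this dist graph unique] show ?thesis .
qed

lemma AE_pair_in_msupport:
  fixes M :: "'a::second_countable_topology measure"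
  assumes M: "M \<in> borel_probs"
  shows "AE z in M \<Otimes>\<^sub>M M. fst z \<in> msupport M \<and> snd z \<in> msupport M"
proof -
  note P = pair_borel_probs[OF M M]
  have "AE z in M \<Otimes>\<^sub>M M. fst z \<in> msupport M"
  proof (rule AE_distrD[OF measurable_fst_borel[OF P]])
    show "AE z in distr (M \<Otimes>\<^sub>M M) borel fst. z \<in> msupport M"
      by (subst distr_borel_pair_fst[OF M M]) (rule AE_in_msupport[OF M])
  qed
  moreover have "AE z in M \<Otimes>\<^sub>M M. snd z \<in> msupport M"
  proof (rule AE_distrD[OF measurable_snd_borel[OF P]])
    show "AE z in distr (M \<Otimes>\<^sub>M M) borel snd. z \<in> msupport M"
      by (subst distr_borel_pair_snd[OF M M]) (rule AE_in_msupport[OF M])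
  qed
  ultimately show ?thesis by eventually_elim simp
qed

section \<open>Couplings of zero energy\<close>

text \<open>Both weights are strictly positive, so the sum vanishes only if both discrepancies
  do.\<close>

lemma fgw_cost_eq_0_iff:
  assumes "0 < \<alpha>" "\<alpha> < 1"
  shows "fgw_cost p q \<alpha> w w' = 0 \<longleftrightarrow> snd (fst w) = snd (snd w) \<and>
    dist (fst (fst w)) (fst (fst w')) = dist (fst (snd w)) (fst (snd w'))"
  using assms by (simp add: fgw_cost_eq add_nonneg_eq_0_iff)

lemma fgw_energy_eq_0_iff:
  assumes p: "p \<ge> 1" "q \<ge> 1" "0 < \<alpha>" "\<alpha> < 1" and \<pi>: "\<pi> \<in> borel_probs"
  shows "fgw_energy p q \<alpha> \<pi> = 0 \<longleftrightarrow> (\<forall>w\<in>msupport \<pi>. \<forall>w'\<in>msupport \<pi>. fgw_cost p q \<alpha> w w' = 0)"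
proof
  note P = pair_borel_probs[OF \<pi> \<pi>]
  have "(\<lambda>(w, w'). fgw_cost p q \<alpha> w w') \<in> borel_measurable (\<pi> \<Otimes>\<^sub>M \<pi>)"
    using borel_measurable_continuous_onI[OF continuous_on_fgw_cost[OF p]] by (simp add: measurable_borel_probs[OF P])
  then have m: "(\<lambda>z. ennreal (fgw_cost p q \<alpha> (fst z) (snd z))) \<in> borel_measurable (\<pi> \<Otimes>\<^sub>M \<pi>)"
    by (simp add: case_prod_beta)
  {
    assume "fgw_energy p q \<alpha> \<pi> = 0"
    then have "AE z in \<pi> \<Otimes>\<^sub>M \<pi>. ennreal (fgw_cost p q \<alpha> (fst z) (snd z)) = 0"
      unfolding fgw_energy_eq[OF p \<pi>] using m by (simp add: nn_integral_0_iff_AE)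
    then have AE: "AE z in \<pi> \<Otimes>\<^sub>M \<pi>. z \<in> {z. (\<lambda>(w, w'). fgw_cost p q \<alpha> w w') z = 0}"
    proof eventually_elim
      case (elim z)
      then have "fgw_cost p q \<alpha> (fst z) (snd z) \<le> 0" by (simp add: ennreal_eq_0_iff)
      with fgw_cost_nonneg[of p q \<alpha> "fst z" "snd z"] show ?case by (simp add: case_prod_beta)
    qed
    have "closed {z. (\<lambda>(w, w'). fgw_cost p q \<alpha> w w') z = 0}"
      by (intro closed_Collect_eq continuous_on_fgw_cost p continuous_on_const)
    then show "\<forall>w\<in>msupport \<pi>. \<forall>w'\<in>msupport \<pi>. fgw_cost p q \<alpha> w w' = 0"
      using msupport_pair_in_closed[OF \<pi> AE] by auto
  }
  assume *: "\<forall>w\<in>msupport \<pi>. \<forall>w'\<in>msupport \<pi>. fgw_cost p q \<alpha> w w' = 0"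
  have "AE z in \<pi> \<Otimes>\<^sub>M \<pi>. ennreal (fgw_cost p q \<alpha> (fst z) (snd z)) = 0"
    using AE_pair_in_msupport[OF \<pi>] by eventually_elim (use * in auto)
  then show "fgw_energy p q \<alpha> \<pi> = 0"
    unfolding fgw_energy_eq[OF p \<pi>] using m by (simp add: nn_integral_0_iff_AE)
qed

text \<open>The coupling is the law of the pair \<open>(z, \<phi> z)\<close>, concentrated on the
  graph of \<open>\<phi>\<close>; the value \<open>undefined\<close> is taken off the support, hence
  on a null set only.\<close>

lemma zero_coupling_of_map:
  fixes \<mu> :: "('x::polish_space \<times> 'o::polish_space) measure" and \<nu> :: "('y::polish_space \<times> 'o) measure"
  assumes p: "p \<ge> 1" "q \<ge> 1" "0 < \<alpha>" "\<alpha> < 1" and \<mu>: "\<mu> \<in> borel_probs" and \<nu>: "\<nu> \<in> borel_probs"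
    and push: "push_forward_on (msupport \<mu>) \<phi> \<mu> \<nu>"
    and feat: "\<And>z. z \<in> msupport \<mu> \<Longrightarrow> snd (\<phi> z) = snd z"
    and iso: "\<And>z z'. z \<in> msupport \<mu> \<Longrightarrow> z' \<in> msupport \<mu> \<Longrightarrow> dist (fst z) (fst z') = dist (fst (\<phi> z)) (fst (\<phi> z'))"
  shows "\<exists>\<pi>\<in>couplings \<mu> \<nu>. fgw_energy p q \<alpha> \<pi> = 0"
proof
  let ?g = "\<lambda>z. if z \<in> msupport \<mu> then \<phi> z else undefined"
  have g: "?g \<in> borel_measurable \<mu>" and dg: "distr \<mu> borel ?g = \<nu>"
    using push
    unfolding push_forward_on_iff[OF \<mu> borel_probsD(4)[OF \<nu>] closed_msupport AE_in_msupport[OF \<mu>], of \<phi> undefined]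
    by blast+
  have id: "(\<lambda>z. z) \<in> borel_measurable \<mu>" by (simp add: measurable_borel_probs[OF \<mu>])
  have G: "(\<lambda>z. (z, ?g z)) \<in> borel_measurable \<mu>" using id g by (rule borel_measurable_Pair)
  let ?\<pi> = "distr \<mu> borel (\<lambda>z. (z, ?g z))"
  have "distr ?\<pi> borel fst = \<mu>"
    using distr_distr[OF fst_borel_measurable G] borel_probsD(4)[OF \<mu>] by (simp add: o_def distr_id2)
  moreover have "distr ?\<pi> borel snd = \<nu>"
    using distr_distr[OF snd_borel_measurable G] dg by (simp add: o_def)
  ultimately show "?\<pi> \<in> couplings \<mu> \<nu>" by (simp add: couplings_def)
  have "AE z in \<mu> \<Otimes>\<^sub>M \<mu>. ennreal (fgw_cost p q \<alpha> (fst z, ?g (fst z)) (snd z, ?g (snd z))) = 0"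
    using AE_pair_in_msupport[OF \<mu>]
  proof eventually_elim
    case (elim z)
    then have "fgw_cost p q \<alpha> (fst z, ?g (fst z)) (snd z, ?g (snd z)) = 0"
      unfolding fgw_cost_eq_0_iff[OF p(3,4)] using feat iso by simp
    then show ?case by simp
  qed
  then have "(\<integral>\<^sup>+z. ennreal (fgw_cost p q \<alpha> (fst z, ?g (fst z)) (snd z, ?g (snd z))) \<partial>(\<mu> \<Otimes>\<^sub>M \<mu>)) = (\<integral>\<^sup>+z. 0 \<partial>(\<mu> \<Otimes>\<^sub>M \<mu>))"
    by (rule nn_integral_cong_AE)
  then show "fgw_energy p q \<alpha> ?\<pi> = 0" unfolding fgw_energy_distr[OF p \<mu> G] by simp
qed

lemma msupport_fst:
  fixes \<mu> :: "('x::polish_space \<times> 'o::polish_space) measure"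
  assumes "\<mu> \<in> borel_probs" "z \<in> msupport \<mu>"
  shows "fst z \<in> msupport (marg_struct \<mu>)"
  unfolding marg_struct_def by (intro msupport_distr assms continuous_on_fst continuous_on_id)

lemma marg_struct_borel_probs:
  fixes \<mu> :: "('x::polish_space \<times> 'o::polish_space) measure"
  assumes "\<mu> \<in> borel_probs"
  shows "marg_struct \<mu> \<in> borel_probs"
  using prob_space.prob_space_distr[OF borel_probsD(1)[OF assms] measurable_fst_borel[OF assms]]
  by (simp add: marg_struct_def borel_probs_def)

lemma maps_of_zero_coupling:
  fixes \<mu> :: "('x::polish_space \<times> 'o::polish_space) measure" and \<nu> :: "('y::polish_space \<times> 'o) measure"
  assumes p: "p \<ge> 1" "q \<ge> 1" "0 < \<alpha>" "\<alpha> < 1" and \<mu>: "\<mu> \<in> borel_probs" and \<nu>: "\<nu> \<in> borel_probs"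
    and c: "\<pi> \<in> couplings \<mu> \<nu>" and zero: "fgw_energy p q \<alpha> \<pi> = 0"
  obtains \<phi> I where "bij_betw \<phi> (msupport \<mu>) (msupport \<nu>)" "push_forward_on (msupport \<mu>) \<phi> \<mu> \<nu>"
    "\<And>z. z \<in> msupport \<mu> \<Longrightarrow> \<phi> z = (I (fst z), snd z)"
    "I ` msupport (marg_struct \<mu>) = msupport (marg_struct \<nu>)"
    "push_forward_on (msupport (marg_struct \<mu>)) I (marg_struct \<mu>) (marg_struct \<nu>)"
    "\<And>x x'. x \<in> msupport (marg_struct \<mu>) \<Longrightarrow> x' \<in> msupport (marg_struct \<mu>) \<Longrightarrow> dist x x' = dist (I x) (I x')"
proof -
  have \<pi>: "\<pi> \<in> borel_probs" by (rule couplings_borel_probs[OF \<mu> c])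
  note cD = couplingsD[OF c]
  have feat: "snd (fst w) = snd (snd w)" if "w \<in> msupport \<pi>" for w
    using zero that unfolding fgw_energy_eq_0_iff[OF p \<pi>] fgw_cost_eq_0_iff[OF p(3,4)] by blast
  have iso: "dist (fst (fst w)) (fst (fst w')) = dist (fst (snd w)) (fst (snd w'))"
    if "w \<in> msupport \<pi>" "w' \<in> msupport \<pi>" for w w'
    using zero that unfolding fgw_energy_eq_0_iff[OF p \<pi>] fgw_cost_eq_0_iff[OF p(3,4)] by blast
  \<comment> \<open>On the support the features agree, so the feature parts of the two product
    distances coincide and equality of the structure parts suffices.\<close>
  have "AE z in \<pi> \<Otimes>\<^sub>M \<pi>. dist (fst (fst z)) (fst (snd z)) = dist (snd (fst z)) (snd (snd z))"
    using AE_pair_in_msupport[OF \<pi>]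
  proof eventually_elim
    case (elim z)
    then show ?case using feat iso by (simp add: dist_prod_def)
  qed
  then obtain \<phi> where
    bij: "bij_betw \<phi> (msupport \<mu>) (msupport \<nu>)" and push: "push_forward_on (msupport \<mu>) \<phi> \<mu> \<nu>"
    and graph: "\<And>z. z \<in> msupport \<mu> \<Longrightarrow> (z, \<phi> z) \<in> msupport \<pi>"
    by (rule isometric_coupling[OF \<mu> \<nu> c]) (rule that)
  let ?f = "\<lambda>w :: ('x \<times> 'o) \<times> 'y \<times> 'o. (fst (fst w), fst (snd w))"
  define \<rho> where "\<rho> = distr \<pi> borel ?f"
  have cf: "continuous_on UNIV ?f" by (intro continuous_intros)
  have f: "?f \<in> borel_measurable \<pi>"
    using borel_measurable_continuous_onI[OF cf] by (simp add: measurable_borel_probs[OF \<pi>])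
  have \<rho>: "\<rho> \<in> couplings (marg_struct \<mu>) (marg_struct \<nu>)"
  proof -
    have "distr \<rho> borel fst = marg_struct \<mu>"
      using distr_distr[OF fst_borel_measurable f] distr_distr[OF fst_borel_measurable measurable_fst_borel[OF \<pi>]]
      by (simp add: \<rho>_def marg_struct_def o_def flip: cD(2))
    moreover have "distr \<rho> borel snd = marg_struct \<nu>"
      using distr_distr[OF snd_borel_measurable f] distr_distr[OF fst_borel_measurable measurable_snd_borel[OF \<pi>]]
      by (simp add: \<rho>_def marg_struct_def o_def flip: cD(3))
    ultimately show ?thesis by (simp add: couplings_def \<rho>_def)
  qed
  have AE: "AE z in \<rho> \<Otimes>\<^sub>M \<rho>. dist (fst (fst z)) (fst (snd z)) = dist (snd (fst z)) (snd (snd z))"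
  proof -
    interpret prob_space \<pi> by (rule borel_probsD[OF \<pi>])
    have \<rho>p: "prob_space \<rho>" unfolding \<rho>_def by (rule prob_space_distr[OF f])
    let ?h = "\<lambda>(x, y). (?f x, ?f y)"
    let ?C = "{z :: ('x \<times> 'y) \<times> 'x \<times> 'y. dist (fst (fst z)) (fst (snd z)) = dist (snd (fst z)) (snd (snd z))}"
    have eq: "\<rho> \<Otimes>\<^sub>M \<rho> = distr (\<pi> \<Otimes>\<^sub>M \<pi>) (borel \<Otimes>\<^sub>M borel) ?h"
      using \<rho>p unfolding \<rho>_def by (intro pair_measure_distr f prob_space_imp_sigma_finite)
    have h: "?h \<in> measurable (\<pi> \<Otimes>\<^sub>M \<pi>) (borel \<Otimes>\<^sub>M borel)"
      using f by measurable
    have "?C \<in> sets (borel \<Otimes>\<^sub>M borel)"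
      unfolding borel_prod by (intro borel_closed closed_Collect_eq continuous_intros)
    then have "{z \<in> space (borel \<Otimes>\<^sub>M borel). z \<in> ?C} \<in> sets (borel \<Otimes>\<^sub>M borel)"
      by (simp add: space_pair_measure)
    from AE_distr_iff[OF h this] have iff: "(AE z in \<rho> \<Otimes>\<^sub>M \<rho>. z \<in> ?C) \<longleftrightarrow> (AE z in \<pi> \<Otimes>\<^sub>M \<pi>. ?h z \<in> ?C)"
      unfolding eq .
    have "AE z in \<pi> \<Otimes>\<^sub>M \<pi>. ?h z \<in> ?C"
      using AE_pair_in_msupport[OF \<pi>] by eventually_elim (use iso in \<open>simp add: case_prod_beta\<close>)
    then show ?thesis using iff by simp
  qed
  obtain I where
    I: "bij_betw I (msupport (marg_struct \<mu>)) (msupport (marg_struct \<nu>))"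
      "push_forward_on (msupport (marg_struct \<mu>)) I (marg_struct \<mu>) (marg_struct \<nu>)"
      "\<And>z z'. z \<in> msupport (marg_struct \<mu>) \<Longrightarrow> z' \<in> msupport (marg_struct \<mu>) \<Longrightarrow> dist z z' = dist (I z) (I z')"
    and uni: "\<And>z v. (z, v) \<in> msupport \<rho> \<Longrightarrow> z \<in> msupport (marg_struct \<mu>) \<and> v = I z"
    by (rule isometric_coupling[OF marg_struct_borel_probs[OF \<mu>] marg_struct_borel_probs[OF \<nu>] \<rho> AE]) (rule that)
  have "\<phi> z = (I (fst z), snd z)" if z: "z \<in> msupport \<mu>" for z
  proof -
    \<comment> \<open>The projection is continuous and maps the support of \<open>\<pi>\<close> into
      that of \<open>\<rho>\<close>, which is the graph of \<open>I\<close>; this rules out a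
      dependence on the feature.\<close>
    have "(fst z, fst (\<phi> z)) \<in> msupport \<rho>"
      using msupport_distr[OF \<pi> cf graph[OF z]] by (simp add: \<rho>_def)
    then have "fst (\<phi> z) = I (fst z)" using uni by simp
    moreover have "snd (\<phi> z) = snd z" using feat[OF graph[OF z]] by simp
    ultimately show ?thesis by (simp add: prod_eq_iff)
  qed
  from that[OF bij push this bij_betw_imp_surj_on[OF I(1)] I(2,3)] show ?thesis .
qed

theorem theorem3p5p1:
  fixes p q \<alpha> :: real
    and \<mu> :: "('x::polish_space \<times> 'o::polish_space) measure"
    and \<nu> :: "('y::polish_space \<times> 'o) measure"
  assumes "p \<ge> 1" and "q \<ge> 1" and "0 < \<alpha>" and "\<alpha> < 1"
    and "\<mu> \<in> structured_objects (p * q)" and "\<nu> \<in> structured_objects (p * q)"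
  shows
    "(\<exists>\<pi>\<in>couplings \<mu> \<nu>.
        fgw_energy p q \<alpha> \<pi> = (INF \<rho>\<in>couplings \<mu> \<nu>. fgw_energy p q \<alpha> \<rho>) \<and>
        FGW \<alpha> p q \<mu> \<nu> = ennreal_power (fgw_energy p q \<alpha> \<pi>) (1 / p) \<and>
        FGW \<alpha> p q \<mu> \<nu> < \<infinity>) \<and>
     FGW \<alpha> p q \<mu> \<nu> = FGW \<alpha> p q \<nu> \<mu> \<and>
     (\<forall>\<beta> :: ('z::polish_space \<times> 'o) measure. \<beta> \<in> structured_objects (p * q) \<longrightarrow>
        (q = 1 \<longrightarrow> FGW \<alpha> p q \<mu> \<nu> \<le> FGW \<alpha> p q \<mu> \<beta> + FGW \<alpha> p q \<beta> \<nu>) \<and>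
        (q \<ge> 2 \<longrightarrow> FGW \<alpha> p q \<mu> \<nu> \<le>
           ennreal (2 powr (q - 1)) * (FGW \<alpha> p q \<mu> \<beta> + FGW \<alpha> p q \<beta> \<nu>))) \<and>
     (FGW \<alpha> p q \<mu> \<nu> = 0 \<longleftrightarrow>
        (\<exists>\<phi> :: 'x \<times> 'o \<Rightarrow> 'y \<times> 'o.
           bij_betw \<phi> (msupport \<mu>) (msupport \<nu>) \<and>
           push_forward_on (msupport \<mu>) \<phi> \<mu> \<nu> \<and>
           (\<forall>(x, a)\<in>msupport \<mu>. snd (\<phi> (x, a)) = a) \<and>
           (\<forall>(x, a)\<in>msupport \<mu>. \<forall>(x', a')\<in>msupport \<mu>.
              dist x x' = dist (fst (\<phi> (x, a))) (fst (\<phi> (x', a')))))) \<and>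
     (generalized_labeled_graph \<mu> \<and> generalized_labeled_graph \<nu> \<longrightarrow>
        (FGW \<alpha> p q \<mu> \<nu> = 0 \<longleftrightarrow> strongly_isomorphic_II \<mu> \<nu>))"
proof -
  note p = assms(1-4)
  have \<mu>: "\<mu> \<in> borel_probs" and \<nu>: "\<nu> \<in> borel_probs"
    using assms structured_objects_borel_probs by auto
  obtain \<pi> where \<pi>: "\<pi> \<in> couplings \<mu> \<nu>"
    and opt: "fgw_energy p q \<alpha> \<pi> = (INF \<rho>\<in>couplings \<mu> \<nu>. fgw_energy p q \<alpha> \<rho>)"
    using exists_optimal_coupling[OF \<mu> \<nu> continuous_on_fgw_cost[OF p] fgw_cost_nonneg]
    unfolding fgw_energy_def by blast
  have F: "FGW \<alpha> p q \<mu> \<nu> = ennreal_power (fgw_energy p q \<alpha> \<pi>) (1 / p)" by (simp add: FGW_def opt)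
  have fin: "FGW \<alpha> p q \<mu> \<nu> < \<infinity>"
    using fgw_energy_finite[OF p assms(5,6) \<pi>] by (simp add: F ennreal_power_def)
  \<comment> \<open>Attainment is essential here: a vanishing infimum has to produce a coupling of
    zero energy.\<close>
  have zero: "FGW \<alpha> p q \<mu> \<nu> = 0 \<longleftrightarrow> (\<exists>\<rho>\<in>couplings \<mu> \<nu>. fgw_energy p q \<alpha> \<rho> = 0)"
  proof -
    have "FGW \<alpha> p q \<mu> \<nu> = 0 \<longleftrightarrow> fgw_energy p q \<alpha> \<pi> = 0"
      using fgw_energy_finite[OF p assms(5,6) \<pi>]
      by (cases "fgw_energy p q \<alpha> \<pi>") (auto simp: F ennreal_power_def)
    also have "\<dots> \<longleftrightarrow> (\<exists>\<rho>\<in>couplings \<mu> \<nu>. fgw_energy p q \<alpha> \<rho> = 0)"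
      using \<pi> opt by (metis INF_lower le_zero_eq)
    finally show ?thesis .
  qed
  have swap: "FGW \<alpha> p q \<mu> \<nu> = FGW \<alpha> p q \<nu> \<mu>"
    using antisym[OF INF_fgw_energy_swap_le[OF p \<nu>, of \<mu>] INF_fgw_energy_swap_le[OF p \<mu>, of \<nu>]]
    by (simp add: FGW_def)
  have tri: "(q = 1 \<longrightarrow> FGW \<alpha> p q \<mu> \<nu> \<le> FGW \<alpha> p q \<mu> \<beta> + FGW \<alpha> p q \<beta> \<nu>) \<and>
        (q \<ge> 2 \<longrightarrow> FGW \<alpha> p q \<mu> \<nu> \<le> ennreal (2 powr (q - 1)) * (FGW \<alpha> p q \<mu> \<beta> + FGW \<alpha> p q \<beta> \<nu>))"
    if "\<beta> \<in> structured_objects (p * q)" for \<beta> :: "('z \<times> 'o) measure"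
    using FGW_triangle[OF p assms(5,6) that] by auto
  have ii: "FGW \<alpha> p q \<mu> \<nu> = 0 \<longleftrightarrow>
        (\<exists>\<phi> :: 'x \<times> 'o \<Rightarrow> 'y \<times> 'o.
           bij_betw \<phi> (msupport \<mu>) (msupport \<nu>) \<and>
           push_forward_on (msupport \<mu>) \<phi> \<mu> \<nu> \<and>
           (\<forall>(x, a)\<in>msupport \<mu>. snd (\<phi> (x, a)) = a) \<and>
           (\<forall>(x, a)\<in>msupport \<mu>. \<forall>(x', a')\<in>msupport \<mu>.
              dist x x' = dist (fst (\<phi> (x, a))) (fst (\<phi> (x', a')))))" (is "_ \<longleftrightarrow> (\<exists>\<phi>. ?iso \<phi>)")
  proof
    assume "FGW \<alpha> p q \<mu> \<nu> = 0"
    then obtain \<rho> where "\<rho> \<in> couplings \<mu> \<nu>" "fgw_energy p q \<alpha> \<rho> = 0" using zero by blast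
    from maps_of_zero_coupling[OF p \<mu> \<nu> this] obtain \<phi> I where
      "bij_betw \<phi> (msupport \<mu>) (msupport \<nu>)" "push_forward_on (msupport \<mu>) \<phi> \<mu> \<nu>"
      and \<phi>: "\<And>z. z \<in> msupport \<mu> \<Longrightarrow> \<phi> z = (I (fst z), snd z)"
      "\<And>x x'. x \<in> msupport (marg_struct \<mu>) \<Longrightarrow> x' \<in> msupport (marg_struct \<mu>) \<Longrightarrow> dist x x' = dist (I x) (I x')"
      by metis
    \<comment> \<open>Support points of \<open>\<mu>\<close> project to support points of its
      structure marginal, where \<open>I\<close> is isometric.\<close>
    moreover have "dist x x' = dist (I x) (I x')" if "(x, a) \<in> msupport \<mu>" "(x', a') \<in> msupport \<mu>" for x a x' a'
      using msupport_fst[OF \<mu> that(1)] msupport_fst[OF \<mu> that(2)] \<phi>(2) by simp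
    ultimately have "?iso \<phi>" by (auto simp: \<phi>(1))
    then show "\<exists>\<phi>. ?iso \<phi>" by blast
  next
    assume "\<exists>\<phi>. ?iso \<phi>"
    then obtain \<phi> where "?iso \<phi>" by blast
    then have "push_forward_on (msupport \<mu>) \<phi> \<mu> \<nu>" "\<And>z. z \<in> msupport \<mu> \<Longrightarrow> snd (\<phi> z) = snd z"
      "\<And>z z'. z \<in> msupport \<mu> \<Longrightarrow> z' \<in> msupport \<mu> \<Longrightarrow> dist (fst z) (fst z') = dist (fst (\<phi> z)) (fst (\<phi> z'))"
      by fastforce+
    from zero_coupling_of_map[OF p \<mu> \<nu> this] show "FGW \<alpha> p q \<mu> \<nu> = 0" using zero by blast
  qed
  have iii: "FGW \<alpha> p q \<mu> \<nu> = 0 \<longleftrightarrow> strongly_isomorphic_II \<mu> \<nu>"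
  proof
    assume "FGW \<alpha> p q \<mu> \<nu> = 0"
    then obtain \<rho> where "\<rho> \<in> couplings \<mu> \<nu>" "fgw_energy p q \<alpha> \<rho> = 0" using zero by blast
    from maps_of_zero_coupling[OF p \<mu> \<nu> this] obtain \<phi> I where
      \<phi>: "bij_betw \<phi> (msupport \<mu>) (msupport \<nu>)" "push_forward_on (msupport \<mu>) \<phi> \<mu> \<nu>"
      "\<And>z. z \<in> msupport \<mu> \<Longrightarrow> \<phi> z = (I (fst z), snd z)" and
      I: "I ` msupport (marg_struct \<mu>) = msupport (marg_struct \<nu>)"
      "push_forward_on (msupport (marg_struct \<mu>)) I (marg_struct \<mu>) (marg_struct \<nu>)"
      "\<And>x x'. x \<in> msupport (marg_struct \<mu>) \<Longrightarrow> x' \<in> msupport (marg_struct \<mu>) \<Longrightarrow> dist x x' = dist (I x) (I x')"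
      by metis
    \<comment> \<open>\<open>\<phi>\<close> and the map built from \<open>I\<close> are known to
      agree on the support only, so bijectivity and push-forward are transferred by
      congruence.\<close>
    have eq: "(\<lambda>(x, a). (I x, a)) z = \<phi> z" if "z \<in> msupport \<mu>" for z
      using \<phi>(3)[OF that] by (simp add: case_prod_beta)
    have "bij_betw (\<lambda>(x, a). (I x, a)) (msupport \<mu>) (msupport \<nu>)"
      by (rule iffD2[OF bij_betw_cong \<phi>(1)]) (rule eq)
    moreover have "push_forward_on (msupport \<mu>) (\<lambda>(x, a). (I x, a)) \<mu> \<nu>"
      by (rule iffD2[OF push_forward_on_cong \<phi>(2)]) (rule eq)
    ultimately show "strongly_isomorphic_II \<mu> \<nu>"
      unfolding strongly_isomorphic_II_def using I by blast
  next
    assume "strongly_isomorphic_II \<mu> \<nu>"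
    then obtain I :: "'x \<Rightarrow> 'y" where
      iso: "\<And>x x'. x \<in> msupport (marg_struct \<mu>) \<Longrightarrow> x' \<in> msupport (marg_struct \<mu>) \<Longrightarrow> dist x x' = dist (I x) (I x')"
      and push: "push_forward_on (msupport \<mu>) (\<lambda>(x, a). (I x, a)) \<mu> \<nu>"
      unfolding strongly_isomorphic_II_def by blast
    have "\<exists>\<rho>\<in>couplings \<mu> \<nu>. fgw_energy p q \<alpha> \<rho> = 0"
      using iso msupport_fst[OF \<mu>]
      by (intro zero_coupling_of_map[OF p \<mu> \<nu> push]) (simp_all add: case_prod_beta)
    then show "FGW \<alpha> p q \<mu> \<nu> = 0" using zero by blast
  qed
  show ?thesis
    using \<pi> opt F fin swap tri ii iii by (intro conjI bexI[of _ \<pi>] allI impI) blast+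
qed

end
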